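(* Let $M$, $A$, $I$, $\nu$, $\mathcal{B}(A,I)$, $\mathcal{B}(A,I)^*$, $\widehat{\mathcal{B}(A,I)}$ be as in the context. Assume that $\varphi \in \mathcal{H}_{\alpha}(\mathcal{B}(A, I))$, $W \in \mathcal{H}_{\alpha}(\widehat{\mathcal{B}(A, I)})$ and $\varphi^* \in \mathcal{H}_{\alpha}(\mathcal{B}(A, I)^* )$ satisfy $$\varphi^*(y)=\varphi(\tau_y(x))+W(\sigma^*(y)\,|\,\tau_y(x))-W(y|x)\qquad\text{for all }(y|x)\in\widehat{\mathcal{B}(A,I)}.$$ Set $$c := \log\Bigl(\int_{\mathcal{B}(A,I)^*\times\mathcal{B}(A,I)} \mathbf{1}_I(A(y_1,x_1))\,e^{W(y|x)}\,d(\rho_{\varphi^*} \times \rho_{\varphi})(y,x)\Bigr).$$ Then: (1) If we define, for $x\in\mathcal{B}(A,I)$ and $y\in\mathcal{B}(A,I)^*$, $$f(x) = \int_{\mathcal{B}(A,I)^*}\mathbf{1}_I(A(y_1,x_1))\,e^{W(y|x)-c}\,d\rho_{\varphi^*}(y),\qquad f^*(y) = \int_{\mathcal{B}(A,I)}\mathbf{1}_I(A(y_1,x_1))\,e^{W(y|x)-c}\,d\rho_{\varphi}(x),$$ then $\mathcal{L}_{\varphi}(f) = \lambda_{\varphi}f$, $\mathcal{L}_{\varphi^*}(f^* ) = \lambda_{\varphi^*}f^*$, $\int f\,d\rho_{\varphi} = 1 = \int f^*\,d\rho_{\varphi^*}$ and $\lambda_{\varphi} = \lambda_{\varphi^*}$.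 (2) Let $\mu_{\varphi}$ and $\mu_{\varphi^*}$ be the Gibbs states of $\varphi$ and $\varphi^*$. The Borel measure $\mu_{\widehat{\varphi}}$ on $\widehat{\mathcal{B}(A, I)}$ given by $$d\mu_{\widehat{\varphi}}(y,x) := \mathbf{1}_I(A(y_1,x_1))\,e^{W(y|x) - c}\,d(\rho_{\varphi^*} \times \rho_{\varphi})(y,x)$$ is a natural extension of $\mu_\varphi$, in the sense that: for any $\psi \in \mathcal{C}(\mathcal{B}(A, I))$, the function $\widehat{\psi} \in \mathcal{C}(\widehat{\mathcal{B}(A, I)})$ defined by $\widehat{\psi}(y|x) = \psi(x)$ satisfies $\int\widehat{\psi}\,d\mu_{\widehat{\varphi}} = \int\psi\,d\mu_{\varphi}$; and for any $\psi^* \in \mathcal{C}(\mathcal{B}(A, I)^* )$, the function $\widehat{\psi} \in \mathcal{C}(\widehat{\mathcal{B}(A, I)})$ defined by $\widehat{\psi}(y|x) = \psi^*(y)$ satisfies $\int\widehat{\psi}\,d\mu_{\widehat{\varphi}} = \int\psi^*\,d\mu_{\varphi^*}$. Furthermore, any (weak* ) accumulation point $\widehat{\mu}_\infty$ of the family $(\mu_{t \widehat{\varphi}})_{t > 1}$ as $t\to\infty$ is maximizing for the potential $\widehat{\varphi}$, where $\widehat\varphi(y|x)=\varphi(x)$, in the sense that $$\int\widehat{\varphi}\,d\widehat{\mu}_\infty = m(\varphi).$$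
   Context: $(M,d_M)$ is a compact metric space, $\mathbb{N}=\{1,2,\dots\}$, and $X=M^{\mathbb{N}}$ has the metric $d(x,y)=\sum_{n\ge1}2^{-n}d_M(x_n,y_n)$ and shift $\sigma((x_n)_n)=(x_{n+1})_n$. $A:M\times M\to\mathbb{R}$ is continuous and $I\subset\mathbb{R}$ is compact; $\mathbf{1}_I$ is the characteristic function of $I$. $\mathcal{B}(A,I)=\{x\in X:A(x_n,x_{n+1})\in I\ \forall n\}$. For $b\in M$, $s(b)=\{a\in M:A(a,b)\in I\}$ and $s^*(b)=\{a\in M:A(b,a)\in I\}$. $\nu$ is a fixed Borel probability measure on $M$ with full support. Standing assumptions: $s$ is locally constant (each $b\in M$ has an open neighborhood on which $s$ is constant); $\mathcal{B}(A,I)$ is topologically transitive (for nonempty open $U,V$ there is $n\in\mathbb{N}$ with $\sigma^{-n}(U)\cap V\ne\emptyset$) and admits a spectral decomposition: it is a union of finitely many pairwise disjoint closed sets $\mathcal{B}(A,I)_1,\dots,\mathcal{B}(A,I)_k$ with $\sigma(\mathcal{B}(A,I)_i)=\mathcal{B}(A,I)_{\mathbf{p}(i)}$ for a permutation $\mathbf{p}$ of $\{1,\dots,k\}$, each $\mathcal{B}(A,I)_i$ being topologically mixing for $\sigma^{m_i}$, where $m_i$ is the least positive integer with $\mathbf{p}^{m_i}(i)=i$. (A map $T$ on $Y$ is topologically mixing if for nonempty open $U,V\subset Y$ there is $n$ with $T^{-m}(U)\cap V\neq\emptyset$ for all $m\ge n$.) The transpose subshift is $\mathcal{B}(A,I)^*=\{y=(\dots,y_2,y_1):y_i\in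 M,\ A(y_{i+1},y_i)\in I\ \forall i\in\mathbb{N}\}$ with the map $\sigma^*(\dots,y_2,y_1)=(\dots,y_3,y_2)$ and the analogous metric. The bilateral subshift is $\widehat{\mathcal{B}(A,I)}=\{(y,x)\in\mathcal{B}(A,I)^*\times\mathcal{B}(A,I):A(y_1,x_1)\in I\}$, whose elements are written $(y|x)$, with the product metric. For $(y|x)\in\widehat{\mathcal{B}(A,I)}$, $\tau_y(x)=(y_1,x_1,x_2,\dots)$. The product $\mathbf{1}_I(A(y_1,x_1))e^{W(y|x)}$ is understood to be $0$ when $(y,x)\notin\widehat{\mathcal{B}(A,I)}$. $\mathcal{H}_\alpha(Y)$ denotes $\alpha$-Hölder continuous functions and $\mathcal{C}(Y)$ continuous functions on $Y$. Ruelle operators: $\mathcal{L}_\varphi(\psi)(x)=\int_{s(x_1)}e^{\varphi(ax)}\psi(ax)\,d\nu(a)$, $ax=(a,x_1,x_2,\dots)$, and $\mathcal{L}_{\varphi^*}(\psi^* )(y)=\int_{s^*(y_1)}e^{\varphi^*(ya)}\psi^*(ya)\,d\nu(a)$, $ya=(\dots,y_2,y_1,a)$. Their duals act on Borel measures by $\int\psi\,d\mathcal{L}^*\mu=\int\mathcal{L}\psi\,d\mu$ for continuous $\psi$. Ruelle–Perron–Frobenius data: by the paper's Ruelle–Perron–Frobenius theorem, $\mathcal{L}_\varphi$ has a positive, simple eigenvalue $\lambda_\varphi$, maximal in modulus among eigenvalues, with a strictly positive Hölder eigenfunction $f_\varphi$, and there is a Borel probability measure $\rho_\varphi$ (eigenprobability)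 on $\mathcal{B}(A,I)$ with $\mathcal{L}_\varphi^*\rho_\varphi=\lambda_\varphi\rho_\varphi$. The Gibbs state $\mu_\varphi$ is the unique Borel probability measure fixed by $\mathcal{L}^*_{\overline\varphi}$, $\overline\varphi=\varphi+\log f_\varphi-\log(f_\varphi\circ\sigma)-\log\lambda_\varphi$; it satisfies $d\mu_\varphi=f_\varphi\,d\rho_\varphi$ when $f_\varphi$ is normalized by $\int f_\varphi\,d\rho_\varphi=1$. The objects $\lambda_{\varphi^*}$, $\rho_{\varphi^*}$, $\mu_{\varphi^*}$ are defined in the same way for $\mathcal{L}_{\varphi^*}$ on $\mathcal{B}(A,I)^*$ with $\sigma^*$ in place of $\sigma$. For $t>1$, $\mu_{t\widehat\varphi}$ is the measure given by the same formula as $\mu_{\widehat\varphi}$ with $(\varphi,W,\varphi^* )$ replaced by $(t\varphi,tW,t\varphi^* )$ (which satisfy the same relation) and $c$ replaced by the corresponding constant. $m(\varphi)=\sup\{\int\varphi\,d\mu:\mu \text{ a }\sigma\text{-invariant Borel probability measure on }\mathcal{B}(A,I)\}$. *)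

theory Defs
  imports "HOL-Probability.Probability"
begin

section \<open>Sequence spaces\<close>

text \<open>
  A one-sided sequence is a function \<open>x :: nat \<Rightarrow> 'a\<close> with \<open>x n\<close> in the role of the \<open>(n+1)\<close>-st entry; for elements
  \<open>y\<close> of the transpose subshift likewise \<open>y n\<close> is the \<open>(n+1)\<close>-st entry counted from the right end.  With this
  coding both shifts are \<open>shift\<close>, and both concatenations \<open>ax\<close> and \<open>ya\<close> are
  \<open>case_nat a\<close>.
\<close>

definition shift :: "(nat \<Rightarrow> 'a) \<Rightarrow> nat \<Rightarrow> 'a" where
  "shift x = (\<lambda>n. x (Suc n))"

definition seq_dist :: "(nat \<Rightarrow> 'a::metric_space) \<Rightarrow> (nat \<Rightarrow> 'a) \<Rightarrow> real" where
  "seq_dist x y = (\<Sum>n. (1/2) ^ Suc n * dist (x n) (y n))"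

definition pair_dist ::
  "(nat \<Rightarrow> 'a::metric_space) \<times> (nat \<Rightarrow> 'a) \<Rightarrow> (nat \<Rightarrow> 'a) \<times> (nat \<Rightarrow> 'a) \<Rightarrow> real" where
  "pair_dist p q = seq_dist (fst p) (fst q) + seq_dist (snd p) (snd q)"

text \<open>
  All topological notions below refer to the product topology, which is the topology of the type
  \<open>nat \<Rightarrow> 'a\<close>.  The metric \<open>seq_dist\<close> induces it; only Hoelder continuity depends on the metric.
\<close>

lemma seq_dist_summable:
  fixes x y :: "nat \<Rightarrow> 'a::metric_space"
  assumes "compact (UNIV :: 'a set)"
  shows "summable (\<lambda>n. (1/2) ^ Suc n * dist (x n) (y n))"
proof -
  obtain D where D: "\<And>a b :: 'a. dist a b \<le> D"
    using compact_imp_bounded[OF assms] unfolding bounded_two_points by auto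
  have "summable (\<lambda>n. (1/2 :: real) ^ Suc n * D)"
    by (intro summable_mult2) (simp add: summable_geometric)
  then show ?thesis
    by (rule summable_comparison_test') (auto intro!: mult_left_mono D)
qed

lemma open_iff_seq_dist:
  fixes U :: "(nat \<Rightarrow> 'a::metric_space) set"
  assumes M: "compact (UNIV :: 'a set)"
  shows "open U \<longleftrightarrow> (\<forall>x\<in>U. \<exists>e>0. \<forall>y. seq_dist x y < e \<longrightarrow> y \<in> U)"
proof
  assume U: "open U"
  show "\<forall>x\<in>U. \<exists>e>0. \<forall>y. seq_dist x y < e \<longrightarrow> y \<in> U"
  proof
    fix x assume "x \<in> U"
    then obtain X where X: "x \<in> Pi\<^sub>E UNIV X" "\<And>i. open (X i)" "finite {i. X i \<noteq> UNIV}"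
        "Pi\<^sub>E UNIV X \<subseteq> U"
      using product_topology_open_contains_basis[of "\<lambda>_. euclidean" UNIV U x] U
      by (auto simp: open_fun_def)
    have "\<exists>e>0. \<forall>b. dist (x i) b < e \<longrightarrow> b \<in> X i" for i
      using X(1) X(2)[of i] unfolding open_dist by (metis PiE_E UNIV_I dist_commute)
    then obtain e where e: "\<And>i. e i > 0" "\<And>i b. dist (x i) b < e i \<Longrightarrow> b \<in> X i"
      by metis
    let ?F = "{i. X i \<noteq> UNIV}"
    let ?E = "insert 1 ((\<lambda>i. (1/2) ^ Suc i * e i) ` ?F)"
    have fin: "finite ?E" using X(3) by simp
    have "y \<in> U" if y: "seq_dist x y < Min ?E" for y
    proof -
      have "y i \<in> X i" for i
      proof (cases "i \<in> ?F")
        case True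
        have "(1/2) ^ Suc i * dist (x i) (y i) \<le> seq_dist x y"
          unfolding seq_dist_def
          using sum_le_suminf[OF seq_dist_summable[OF M], of "{i}" x y] by simp
        also have "\<dots> < (1/2) ^ Suc i * e i"
          using y Min_le[OF fin, of "(1/2) ^ Suc i * e i"] True by auto
        finally show ?thesis by (intro e(2)) simp
      qed simp
      then show ?thesis using X(4) by auto
    qed
    moreover have "Min ?E > 0"
      using fin e(1) by (subst Min_gr_iff) auto
    ultimately show "\<exists>e>0. \<forall>y. seq_dist x y < e \<longrightarrow> y \<in> U" by blast
  qed
next
  assume U: "\<forall>x\<in>U. \<exists>e>0. \<forall>y. seq_dist x y < e \<longrightarrow> y \<in> U"
  obtain D where D: "\<And>a b :: 'a. dist a b \<le> D"
    using compact_imp_bounded[OF M] unfolding bounded_two_points by auto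
  have cont: "continuous_on UNIV (seq_dist x)" for x :: "nat \<Rightarrow> 'a"
  proof -
    have s: "summable (\<lambda>n. (1/2 :: real) ^ Suc n * D)"
      by (intro summable_mult2) (simp add: summable_geometric)
    have "uniform_limit UNIV (\<lambda>n y. \<Sum>i<n. (1/2) ^ Suc i * dist (x i) (y i))
        (\<lambda>y. \<Sum>i. (1/2) ^ Suc i * dist (x i) (y i)) sequentially"
      by (rule Weierstrass_m_test[OF _ s]) (auto intro!: mult_left_mono D)
    then have "continuous_on UNIV (\<lambda>y. \<Sum>i. (1/2) ^ Suc i * dist (x i) (y i))"
      by (rule uniform_limit_theorem[rotated])
        (auto intro!: always_eventually continuous_intros)
    then show ?thesis by (simp add: seq_dist_def[abs_def])
  qed
  show "open U"
    unfolding open_subopen[of U]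
  proof
    fix x assume "x \<in> U"
    then obtain e where e: "e > 0" "\<And>y. seq_dist x y < e \<Longrightarrow> y \<in> U" using U by blast
    have "open {y. seq_dist x y < e}"
      using cont[of x] by (intro open_Collect_less continuous_on_const) auto
    moreover have "seq_dist x x = 0" by (simp add: seq_dist_def)
    ultimately show "\<exists>T. open T \<and> x \<in> T \<and> T \<subseteq> U"
      using e by (intro exI[of _ "{y. seq_dist x y < e}"]) auto
  qed
qed

definition hoelder_on :: "('x \<Rightarrow> 'x \<Rightarrow> real) \<Rightarrow> real \<Rightarrow> 'x set \<Rightarrow> ('x \<Rightarrow> 'b::real_normed_vector) \<Rightarrow> bool"
where
  "hoelder_on d \<alpha> Y \<psi> \<longleftrightarrow> (\<exists>C\<ge>0. \<forall>x\<in>Y. \<forall>y\<in>Y. norm (\<psi> x - \<psi> y) \<le> C * d x y powr \<alpha>)"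


section \<open>The subshifts\<close>

definition subshift :: "('a \<Rightarrow> 'a \<Rightarrow> real) \<Rightarrow> real set \<Rightarrow> (nat \<Rightarrow> 'a) set" where
  "subshift A I = {x. \<forall>n. A (x n) (x (Suc n)) \<in> I}"

definition transpose_subshift :: "('a \<Rightarrow> 'a \<Rightarrow> real) \<Rightarrow> real set \<Rightarrow> (nat \<Rightarrow> 'a) set" where
  "transpose_subshift A I = {y. \<forall>n. A (y (Suc n)) (y n) \<in> I}"

definition bilateral_subshift ::
  "('a \<Rightarrow> 'a \<Rightarrow> real) \<Rightarrow> real set \<Rightarrow> ((nat \<Rightarrow> 'a) \<times> (nat \<Rightarrow> 'a)) set" where
  "bilateral_subshift A I =
     {(y, x). y \<in> transpose_subshift A I \<and> x \<in> subshift A I \<and> A (y 0) (x 0) \<in> I}"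

definition sect :: "('a \<Rightarrow> 'a \<Rightarrow> real) \<Rightarrow> real set \<Rightarrow> 'a \<Rightarrow> 'a set" where
  "sect A I b = {a. A a b \<in> I}"

definition sect_star :: "('a \<Rightarrow> 'a \<Rightarrow> real) \<Rightarrow> real set \<Rightarrow> 'a \<Rightarrow> 'a set" where
  "sect_star A I b = {a. A b a \<in> I}"

definition tau :: "(nat \<Rightarrow> 'a) \<Rightarrow> (nat \<Rightarrow> 'a) \<Rightarrow> nat \<Rightarrow> 'a" where
  "tau y x = case_nat (y 0) x"

definition locally_constant :: "('a::topological_space \<Rightarrow> 'b) \<Rightarrow> bool" where
  "locally_constant s \<longleftrightarrow> (\<forall>b. \<exists>U. open U \<and> b \<in> U \<and> (\<forall>c\<in>U. s c = s b))"

definition topologically_transitive :: "'x::topological_space set \<Rightarrow> ('x \<Rightarrow> 'x) \<Rightarrow> bool" where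
  "topologically_transitive Y T \<longleftrightarrow>
     (\<forall>U V. openin (top_of_set Y) U \<and> U \<noteq> {} \<and> openin (top_of_set Y) V \<and> V \<noteq> {} \<longrightarrow>
        (\<exists>n\<ge>1. {x \<in> Y. (T ^^ n) x \<in> U} \<inter> V \<noteq> {}))"

definition topologically_mixing :: "'x::topological_space set \<Rightarrow> ('x \<Rightarrow> 'x) \<Rightarrow> bool" where
  "topologically_mixing Y T \<longleftrightarrow>
     (\<forall>U V. openin (top_of_set Y) U \<and> U \<noteq> {} \<and> openin (top_of_set Y) V \<and> V \<noteq> {} \<longrightarrow>
        (\<exists>n. \<forall>m\<ge>n. {x \<in> Y. (T ^^ m) x \<in> U} \<inter> V \<noteq> {}))"

definition spectral_decomposition :: "'x::topological_space set \<Rightarrow> ('x \<Rightarrow> 'x) \<Rightarrow> bool" where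
  "spectral_decomposition Y T \<longleftrightarrow>
     (\<exists>(k::nat) Z p.
        Y = (\<Union>i\<in>{1..k}. Z i) \<and> disjoint_family_on Z {1..k} \<and> p permutes {1..k} \<and>
        (\<forall>i\<in>{1..k}. closed (Z i) \<and> T ` Z i = Z (p i) \<and>
           topologically_mixing (Z i) (T ^^ (LEAST m. m > 0 \<and> (p ^^ m) i = i))))"


section \<open>Measures and Ruelle operators\<close>

definition full_support :: "'a::topological_space measure \<Rightarrow> bool" where
  "full_support \<nu> \<longleftrightarrow> (\<forall>U. open U \<and> U \<noteq> {} \<longrightarrow> emeasure \<nu> U > 0)"

definition borel_prob_on :: "'x::topological_space set \<Rightarrow> 'x measure \<Rightarrow> bool" where
  "borel_prob_on Y \<mu> \<longleftrightarrow> prob_space \<mu> \<and> sets \<mu> = sets (restrict_space borel Y)"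

text \<open>
  The Ruelle operator for the section map \<open>s\<close>, on real- or complex-valued functions.  With
  \<open>sect\<close> it is the operator of the subshift, with \<open>sect_star\<close> that of the transpose
  subshift.  Only its values on the subshift in question matter.
\<close>

definition ruelle ::
  "'a measure \<Rightarrow> ('a \<Rightarrow> 'a set) \<Rightarrow> ((nat \<Rightarrow> 'a) \<Rightarrow> real) \<Rightarrow>
   ((nat \<Rightarrow> 'a) \<Rightarrow> 'b::{banach, second_countable_topology}) \<Rightarrow> (nat \<Rightarrow> 'a) \<Rightarrow> 'b" where
  "ruelle \<nu> s \<phi> \<psi> x = (LINT a:s (x 0)|\<nu>. exp (\<phi> (case_nat a x)) *\<^sub>R \<psi> (case_nat a x))"

text \<open>\<open>ruelle_dual_eq \<nu> Y s \<phi> l \<mu>\<close> says that the dual operator maps \<open>\<mu>\<close> to \<open>l \<mu>\<close>.\<close>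

definition ruelle_dual_eq ::
  "'a::topological_space measure \<Rightarrow> (nat \<Rightarrow> 'a) set \<Rightarrow> ('a \<Rightarrow> 'a set) \<Rightarrow>
   ((nat \<Rightarrow> 'a) \<Rightarrow> real) \<Rightarrow> real \<Rightarrow> (nat \<Rightarrow> 'a) measure \<Rightarrow> bool" where
  "ruelle_dual_eq \<nu> Y s \<phi> l \<mu> \<longleftrightarrow>
     (\<forall>\<psi> :: (nat \<Rightarrow> 'a) \<Rightarrow> real. continuous_on Y \<psi> \<longrightarrow>
        (\<integral>x. ruelle \<nu> s \<phi> \<psi> x \<partial>\<mu>) = l * (\<integral>x. \<psi> x \<partial>\<mu>))"

text \<open>
  \<open>rpf_data \<nu> \<alpha> Y s \<phi> l f \<rho>\<close>: \<open>l\<close> is the positive, simple eigenvalue of the Ruelle operator on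
  \<open>\<alpha>\<close>-Hoelder functions on \<open>Y\<close>, of maximal modulus among all (possibly complex) eigenvalues, \<open>f\<close> is
  a strictly positive eigenfunction and \<open>\<rho>\<close> an eigenprobability.  Simplicity is stated as
  one-dimensionality of the eigenspace.
\<close>

definition rpf_data ::
  "'a::metric_space measure \<Rightarrow> real \<Rightarrow> (nat \<Rightarrow> 'a) set \<Rightarrow> ('a \<Rightarrow> 'a set) \<Rightarrow>
   ((nat \<Rightarrow> 'a) \<Rightarrow> real) \<Rightarrow> real \<Rightarrow> ((nat \<Rightarrow> 'a) \<Rightarrow> real) \<Rightarrow> (nat \<Rightarrow> 'a) measure \<Rightarrow> bool" where
  "rpf_data \<nu> \<alpha> Y s \<phi> l f \<rho> \<longleftrightarrow>
     l > 0 \<and>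
     hoelder_on seq_dist \<alpha> Y f \<and> (\<forall>x\<in>Y. f x > 0) \<and> (\<forall>x\<in>Y. ruelle \<nu> s \<phi> f x = l * f x) \<and>
     (\<forall>\<psi> :: (nat \<Rightarrow> 'a) \<Rightarrow> real.
        hoelder_on seq_dist \<alpha> Y \<psi> \<and> (\<forall>x\<in>Y. ruelle \<nu> s \<phi> \<psi> x = l * \<psi> x) \<longrightarrow>
        (\<exists>k. \<forall>x\<in>Y. \<psi> x = k * f x)) \<and>
     (\<forall>(z::complex) (\<psi> :: (nat \<Rightarrow> 'a) \<Rightarrow> complex).
        hoelder_on seq_dist \<alpha> Y \<psi> \<and> (\<exists>x\<in>Y. \<psi> x \<noteq> 0) \<and> (\<forall>x\<in>Y. ruelle \<nu> s \<phi> \<psi> x = z * \<psi> x) \<longrightarrow>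
        cmod z \<le> l) \<and>
     borel_prob_on Y \<rho> \<and> ruelle_dual_eq \<nu> Y s \<phi> l \<rho>"

definition normalized_potential ::
  "((nat \<Rightarrow> 'a) \<Rightarrow> real) \<Rightarrow> real \<Rightarrow> ((nat \<Rightarrow> 'a) \<Rightarrow> real) \<Rightarrow> (nat \<Rightarrow> 'a) \<Rightarrow> real" where
  "normalized_potential \<phi> l f x = \<phi> x + ln (f x) - ln (f (shift x)) - ln l"

definition gibbs_state ::
  "'a::topological_space measure \<Rightarrow> (nat \<Rightarrow> 'a) set \<Rightarrow> ('a \<Rightarrow> 'a set) \<Rightarrow>
   ((nat \<Rightarrow> 'a) \<Rightarrow> real) \<Rightarrow> real \<Rightarrow> ((nat \<Rightarrow> 'a) \<Rightarrow> real) \<Rightarrow> (nat \<Rightarrow> 'a) measure \<Rightarrow> bool" where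
  "gibbs_state \<nu> Y s \<phi> l f \<mu> \<longleftrightarrow>
     borel_prob_on Y \<mu> \<and> ruelle_dual_eq \<nu> Y s (normalized_potential \<phi> l f) 1 \<mu> \<and>
     (\<forall>\<mu>'. borel_prob_on Y \<mu>' \<and> ruelle_dual_eq \<nu> Y s (normalized_potential \<phi> l f) 1 \<mu>' \<longrightarrow> \<mu>' = \<mu>)"

definition max_integral :: "(nat \<Rightarrow> 'a::topological_space) set \<Rightarrow> ((nat \<Rightarrow> 'a) \<Rightarrow> real) \<Rightarrow> real" where
  "max_integral Y \<phi> = (SUP \<mu>\<in>{\<mu>. borel_prob_on Y \<mu> \<and> distr \<mu> \<mu> shift = \<mu>}. \<integral>x. \<phi> x \<partial>\<mu>)"


section \<open>The bilateral measure\<close>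

text \<open>\<open>W\<close> is only relevant on the bilateral subshift; the indicator makes the kernel vanish elsewhere.\<close>

definition bi_kernel ::
  "('a \<Rightarrow> 'a \<Rightarrow> real) \<Rightarrow> real set \<Rightarrow> ((nat \<Rightarrow> 'a) \<times> (nat \<Rightarrow> 'a) \<Rightarrow> real) \<Rightarrow> real \<Rightarrow>
   (nat \<Rightarrow> 'a) \<Rightarrow> (nat \<Rightarrow> 'a) \<Rightarrow> real" where
  "bi_kernel A I W c y x = indicator I (A (y 0) (x 0)) * exp (W (y, x) - c)"

definition bi_const ::
  "('a \<Rightarrow> 'a \<Rightarrow> real) \<Rightarrow> real set \<Rightarrow> ((nat \<Rightarrow> 'a) \<times> (nat \<Rightarrow> 'a) \<Rightarrow> real) \<Rightarrow>
   (nat \<Rightarrow> 'a) measure \<Rightarrow> (nat \<Rightarrow> 'a) measure \<Rightarrow> real" where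
  "bi_const A I W \<rho>s \<rho> =
     ln (\<integral>(y, x). indicator I (A (y 0) (x 0)) * exp (W (y, x)) \<partial>(\<rho>s \<Otimes>\<^sub>M \<rho>))"

definition bi_measure ::
  "('a \<Rightarrow> 'a \<Rightarrow> real) \<Rightarrow> real set \<Rightarrow> ((nat \<Rightarrow> 'a) \<times> (nat \<Rightarrow> 'a) \<Rightarrow> real) \<Rightarrow> real \<Rightarrow>
   (nat \<Rightarrow> 'a) measure \<Rightarrow> (nat \<Rightarrow> 'a) measure \<Rightarrow> ((nat \<Rightarrow> 'a) \<times> (nat \<Rightarrow> 'a)) measure" where
  "bi_measure A I W c \<rho>s \<rho> =
     restrict_space (density (\<rho>s \<Otimes>\<^sub>M \<rho>) (\<lambda>(y, x). ennreal (bi_kernel A I W c y x)))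
       (bilateral_subshift A I)"

text \<open>
  Accumulation point, as \<open>t \<rightarrow> \<infinity>\<close>, in the weak* topology: every basic neighbourhood of \<open>\<mu>\<close>, given by
  finitely many continuous functions, is visited by the family for arbitrarily large \<open>t\<close>.
\<close>

definition weak_star_accumulation_at_top ::
  "'x::topological_space set \<Rightarrow> (real \<Rightarrow> 'x measure) \<Rightarrow> 'x measure \<Rightarrow> bool" where
  "weak_star_accumulation_at_top Y m \<mu> \<longleftrightarrow>
     borel_prob_on Y \<mu> \<and>
     (\<forall>G e. finite G \<and> (\<forall>g\<in>G. continuous_on Y (g :: 'x \<Rightarrow> real)) \<and> e > 0 \<longrightarrow>
        (\<exists>\<^sub>F t in at_top. \<forall>g\<in>G. \<bar>(\<integral>x. g x \<partial>m t) - (\<integral>x. g x \<partial>\<mu>)\<bar> < e))"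

end

theory Submission
  imports Defs
begin

text \<open>
  Write \<open>y a x\<close> for an admissible concatenation.  The hypothesis on \<open>W\<close> says
  \<open>\<phi>s (y a) + W (y a | x) = \<phi> (a x) + W (y | a x)\<close>: the symbol \<open>a\<close> may cross the bar at the price of exchanging
  \<open>\<phi>\<close> and \<open>\<phi>s\<close>.  Integrate the kernel \<open>K y x = 1 (A (y 0) (x 0) \<in> I) exp (W (y | x) - c)\<close> over \<open>y\<close> with respect to the
  transposed eigenprobability \<open>\<rho>s\<close>.  By Fubini, letting the operator of \<open>\<phi>\<close> act on \<open>x\<close> is the same as letting the operator
  of \<open>\<phi>s\<close> act on \<open>y\<close>, which \<open>\<rho>s\<close> turns into multiplication by \<open>ls\<close> (\<open>transfer_marginal\<close>).  So the marginal density
  \<open>f\<close> is a nonnegative eigenfunction with eigenvalue \<open>ls\<close>.  It is not identically zero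
  (\<open>marginal_positive_somewhere\<close>), hence comparing it with the strictly positive eigenfunction \<open>h\<close> where \<open>f / h\<close>
  is maximal gives \<open>ls \<le> l\<close>; the mirror image of the argument gives \<open>l \<le> ls\<close>.  As \<open>f\<close> is Hoelder, simplicity of the
  eigenvalue makes it a positive multiple of \<open>h\<close>, so the bilateral measure is nonzero and the choice of \<open>c\<close> makes it a
  probability.  Its marginal \<open>f \<rho>\<close> is fixed by the dual of the normalized operator, and uniqueness of the
  Gibbs state identifies it (\<open>gibbs_state_eq\<close>).

  The two sides are treated by one argument, applied to \<open>A\<close> and to \<open>A\<close> with its arguments exchanged.  For that the sections
  \<open>sect_star\<close> must be locally constant as well.  This holds at the first entries of points of the transpose,
  because a jump of the section would be a jump of the strictly positive eigenfunction \<open>hs\<close>, which is an integral over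
  it (\<open>sect_locally_constant\<close>).  Consequently all functions met below are continuous, and the eigenvalue equations for
  the eigenprobabilities apply to them directly.

  For the zero temperature limit let \<open>\<mu>\<^sub>t = f\<^sub>t \<rho>\<^sub>t\<close> be the Gibbs measure of \<open>t \<phi>\<close> and \<open>l\<^sub>t\<close> the eigenvalue.  It is invariant,
  so the mean of \<open>\<phi>\<close> is at most \<open>m \<phi>\<close>.  Its entropy relative to \<open>\<nu>\<close> is at most 0, that is,
  \<open>ln l\<^sub>t \<le> t \<integral> \<phi> d\<mu>\<^sub>t\<close> (\<open>ln_eigenvalue_le\<close>).  Conversely \<open>\<nu>\<close> gives mass to every ball and \<open>ln f\<^sub>t / t\<close> has a Hoelder constant
  that is independent of \<open>t\<close>, since \<open>f\<^sub>t\<close> is an average of \<open>exp (t W)\<close>; hence \<open>t \<integral> \<phi> d\<mu> \<le> ln l\<^sub>t + o(t)\<close> uniformly in the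
  invariant measure \<open>\<mu>\<close> (\<open>integral_le_ln_eigenvalue\<close>).  Together the means of \<open>\<phi>\<close> converge to \<open>m \<phi>\<close>, and
  accumulation points inherit this value.
\<close>


section \<open>Sequence spaces over a compact metric space\<close>

lemma seq_dist_nonneg:
  fixes x y :: "nat \<Rightarrow> 'a::metric_space"
  assumes "compact (UNIV :: 'a set)"
  shows "seq_dist x y \<ge> 0"
  unfolding seq_dist_def by (intro suminf_nonneg seq_dist_summable[OF assms]) auto

lemma seq_dist_self [simp]: "seq_dist x x = 0"
  by (simp add: seq_dist_def)

lemma seq_dist_split_head:
  fixes x y :: "nat \<Rightarrow> 'a::metric_space"
  assumes "compact (UNIV :: 'a set)"
  shows "seq_dist x y = dist (x 0) (y 0) / 2 + seq_dist (shift x) (shift y) / 2"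
proof -
  note s = seq_dist_summable[OF assms]
  have "seq_dist x y = (\<Sum>n. (1/2) ^ Suc (Suc n) * dist (x (Suc n)) (y (Suc n))) + dist (x 0) (y 0) / 2"
    unfolding seq_dist_def using suminf_split_head[OF s[of x y]] by simp
  also have "(\<Sum>n. (1/2) ^ Suc (Suc n) * dist (x (Suc n)) (y (Suc n)))
      = (\<Sum>n. (1/2) * ((1/2) ^ Suc n * dist (shift x n) (shift y n)))"
    by (simp add: shift_def)
  also have "\<dots> = (1/2) * seq_dist (shift x) (shift y)"
    unfolding seq_dist_def by (rule suminf_mult[OF s])
  finally show ?thesis by simp
qed

lemma shift_case_nat [simp]: "shift (case_nat a x) = x"
  by (simp add: shift_def)

lemma case_nat_shift [simp]: "case_nat (x 0) (shift x) = x"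
  by (rule ext) (simp add: shift_def split: nat.split)

lemma seq_dist_case_nat:
  fixes x y :: "nat \<Rightarrow> 'a::metric_space"
  assumes "compact (UNIV :: 'a set)"
  shows "seq_dist (case_nat a x) (case_nat b y) = dist a b / 2 + seq_dist x y / 2"
  by (subst seq_dist_split_head[OF assms]) simp

lemma dist_head_le_seq_dist:
  fixes x y :: "nat \<Rightarrow> 'a::metric_space"
  assumes "compact (UNIV :: 'a set)"
  shows "dist (x 0) (y 0) \<le> 2 * seq_dist x y"
  using seq_dist_split_head[OF assms, of x y] seq_dist_nonneg[OF assms, of "shift x" "shift y"]
  by simp

lemma seq_dist_triangle:
  fixes x y z :: "nat \<Rightarrow> 'a::metric_space"
  assumes "compact (UNIV :: 'a set)"
  shows "seq_dist x z \<le> seq_dist x y + seq_dist y z"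
proof -
  note s = seq_dist_summable[OF assms]
  have "seq_dist x z \<le> (\<Sum>n. (1/2) ^ Suc n * dist (x n) (y n) + (1/2) ^ Suc n * dist (y n) (z n))"
    unfolding seq_dist_def
    by (intro suminf_le s summable_add)
      (simp add: distrib_left[symmetric] mult_left_mono dist_triangle)
  also have "\<dots> = seq_dist x y + seq_dist y z"
    unfolding seq_dist_def by (rule suminf_add[symmetric]; rule s)
  finally show ?thesis .
qed

lemma seq_dist_bounded:
  assumes "compact (UNIV :: 'a::metric_space set)"
  obtains D where "D > 0" "\<And>x y :: nat \<Rightarrow> 'a. seq_dist x y \<le> D"
proof -
  obtain D where D: "\<And>a b :: 'a. dist a b \<le> D"
    using compact_imp_bounded[OF assms] unfolding bounded_two_points by auto
  have g: "(\<lambda>n. (1/2 :: real) ^ Suc n * D) sums (1 * D)"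
    by (rule sums_mult2[OF power_half_series])
  have "seq_dist x y \<le> D" for x y :: "nat \<Rightarrow> 'a"
  proof -
    have "seq_dist x y \<le> (\<Sum>n. (1/2 :: real) ^ Suc n * D)"
      unfolding seq_dist_def
      by (intro suminf_le seq_dist_summable[OF assms] sums_summable[OF g]) (auto intro!: mult_left_mono D)
    then show ?thesis using sums_unique[OF g] by simp
  qed
  then have "seq_dist x y \<le> max D 1" for x y :: "nat \<Rightarrow> 'a"
    by (simp add: le_max_iff_disj)
  then show ?thesis by (rule that[rotated]) simp
qed

lemma tendsto_seq_dist_at:
  fixes x :: "nat \<Rightarrow> 'a::metric_space"
  assumes "compact (UNIV :: 'a set)"
  shows "((\<lambda>y. seq_dist x y) \<longlongrightarrow> 0) (at x within Y)"
proof (rule tendstoI)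
  fix e :: real assume e: "e > 0"
  have "open {y. seq_dist x y < e}"
    unfolding open_iff_seq_dist[OF assms]
  proof
    fix y assume "y \<in> {y. seq_dist x y < e}"
    moreover have "seq_dist x z < e" if "seq_dist y z < e - seq_dist x y" for z
      using seq_dist_triangle[OF assms, of x z y] that by linarith
    ultimately show "\<exists>d>0. \<forall>z. seq_dist y z < d \<longrightarrow> z \<in> {y. seq_dist x y < e}"
      by (intro exI[of _ "e - seq_dist x y"]) auto
  qed
  then have "\<forall>\<^sub>F y in at x within Y. y \<in> {y. seq_dist x y < e}"
    using e by (intro topological_tendstoD[OF tendsto_ident_at]) auto
  then show "\<forall>\<^sub>F y in at x within Y. dist (seq_dist x y) 0 < e"
    by eventually_elim (simp add: seq_dist_nonneg[OF assms])
qed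

lemma tendsto_powr_zero:
  fixes f :: "'b \<Rightarrow> real"
  assumes "(f \<longlongrightarrow> 0) F" "\<alpha> > 0" "\<And>x. f x \<ge> 0"
  shows "((\<lambda>x. f x powr \<alpha>) \<longlongrightarrow> 0) F"
  using tendsto_powr'[OF assms(1) tendsto_const, of \<alpha>] assms(2,3) by simp

lemma hoelder_on_imp_continuous_on:
  fixes f :: "(nat \<Rightarrow> 'a::metric_space) \<Rightarrow> 'b::real_normed_vector"
  assumes "compact (UNIV :: 'a set)" "\<alpha> > 0" "hoelder_on seq_dist \<alpha> Y f"
  shows "continuous_on Y f"
  unfolding continuous_on_def
proof
  fix x assume x: "x \<in> Y"
  obtain C where C: "\<forall>x\<in>Y. \<forall>y\<in>Y. norm (f x - f y) \<le> C * seq_dist x y powr \<alpha>"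
    using assms(3) unfolding hoelder_on_def by blast
  have "((\<lambda>y. C * seq_dist x y powr \<alpha>) \<longlongrightarrow> C * 0) (at x within Y)"
    by (intro tendsto_mult_left tendsto_powr_zero tendsto_seq_dist_at seq_dist_nonneg assms)
  then have lim: "((\<lambda>y. C * seq_dist x y powr \<alpha>) \<longlongrightarrow> 0) (at x within Y)" by simp
  have "\<forall>\<^sub>F y in at x within Y. norm (f y - f x) \<le> C * seq_dist x y powr \<alpha>"
    unfolding eventually_at_filter
    by (rule always_eventually) (use C x in \<open>auto simp: norm_minus_commute[of _ "f x"]\<close>)
  then have "((\<lambda>y. f y - f x) \<longlongrightarrow> 0) (at x within Y)"
    by (rule Lim_null_comparison[OF _ lim])
  then show "(f \<longlongrightarrow> f x) (at x within Y)" by (rule LIM_zero_cancel)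
qed

text \<open>By Tychonoff's theorem the space of all sequences is compact.\<close>

lemma closed_imp_compact_seq:
  fixes Y :: "(nat \<Rightarrow> 'a::metric_space) set"
  assumes "compact (UNIV :: 'a set)" "closed Y"
  shows "compact Y"
proof -
  have "compact_space (product_topology (\<lambda>_::nat. euclidean :: 'a topology) UNIV)"
    using assms(1) unfolding compact_space_product_topology by (simp add: compact_space_def)
  then have "compact (UNIV :: (nat \<Rightarrow> 'a) set)"
    unfolding euclidean_product_topology by (simp add: compact_space_def)
  then show ?thesis using compact_Int_closed[OF _ assms(2)] by fastforce
qed

lemma continuous_on_case_nat:
  "continuous_on S (\<lambda>a. case_nat a (x :: nat \<Rightarrow> 'a::topological_space))"
proof (rule continuous_on_coordinatewise_then_product)
  show "continuous_on S (\<lambda>a. case_nat a x n)" for n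
    by (cases n) (auto intro: continuous_intros)
qed

lemma continuous_on_shift: "continuous_on S (shift :: (nat \<Rightarrow> 'a::topological_space) \<Rightarrow> _)"
  unfolding shift_def
  by (rule continuous_on_coordinatewise_then_product)
    (rule continuous_on_subset[OF continuous_on_product_coordinates], simp)

section \<open>Borel probability measures on closed sets of sequences\<close>

lemma borel_prob_on_space: "borel_prob_on Y \<mu> \<Longrightarrow> space \<mu> = Y"
  unfolding borel_prob_on_def using sets_eq_imp_space_eq[of \<mu> "restrict_space borel Y"] by (simp add: space_restrict_space)

lemma borel_prob_on_measurable_restrict:
  assumes "borel_prob_on Y \<mu>" "f \<in> measurable (restrict_space borel Y) N"
  shows "f \<in> measurable \<mu> N"
  using assms measurable_cong_sets[of \<mu> "restrict_space borel Y" N N] unfolding borel_prob_on_def by blast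

lemma borel_prob_on_measurable_borel:
  assumes "borel_prob_on Y \<mu>" "f \<in> measurable borel N"
  shows "f \<in> measurable \<mu> N"
  by (rule borel_prob_on_measurable_restrict[OF assms(1) measurable_restrict_space1[OF assms(2)]])

lemma borel_prob_on_integrable_continuous:
  fixes g :: "'x::topological_space \<Rightarrow> real"
  assumes "borel_prob_on Y \<mu>" "compact Y" "continuous_on Y g"
  shows "g \<in> borel_measurable \<mu>" "integrable \<mu> g"
proof -
  interpret prob_space \<mu> using assms(1) by (simp add: borel_prob_on_def)
  show m: "g \<in> borel_measurable \<mu>"
    by (rule borel_prob_on_measurable_restrict[OF assms(1)])
      (rule borel_measurable_continuous_on_restrict[OF assms(3)])
  obtain C where C: "\<And>x. x \<in> Y \<Longrightarrow> norm (g x) \<le> C"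
    using compact_imp_bounded[OF compact_continuous_image[OF assms(3,2)]] unfolding bounded_iff by blast
  show "integrable \<mu> g"
    by (rule integrable_const_bound[of _ C]) (use C in \<open>auto simp: m borel_prob_on_space[OF assms(1)] intro!: AE_I2\<close>)
qed

lemma borel_prob_on_integrable_indicator:
  fixes g :: "'x::t2_space \<Rightarrow> real"
  assumes "borel_prob_on Y \<mu>" "compact S" "continuous_on S g"
  shows "integrable \<mu> (\<lambda>x. indicator S x * g x)"
proof -
  interpret prob_space \<mu> using assms(1) by (simp add: borel_prob_on_def)
  have "(\<lambda>x. indicator S x *\<^sub>R g x) \<in> borel_measurable borel"
    using assms(3) compact_imp_closed[OF assms(2)] by (intro borel_measurable_continuous_on_indicator) auto
  then have m: "(\<lambda>x. indicator S x * g x) \<in> borel_measurable \<mu>"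
    using borel_prob_on_measurable_borel[OF assms(1)] by simp
  obtain C where C: "\<And>x. x \<in> S \<Longrightarrow> norm (g x) \<le> C"
    using compact_imp_bounded[OF compact_continuous_image[OF assms(3,2)]] unfolding bounded_iff by blast
  have "norm (indicator S x * g x) \<le> max C 0" for x
    using C[of x] by (cases "x \<in> S") auto
  then show ?thesis by (intro integrable_const_bound[of _ "max C 0"] m) simp
qed

lemma borel_prob_on_nonempty: "borel_prob_on Y \<mu> \<Longrightarrow> Y \<noteq> {}"
  using prob_space.not_empty[of \<mu>] borel_prob_on_space[of Y \<mu>] by (auto simp: borel_prob_on_def)

text \<open>
  The indicator of an open set is the pointwise limit of the functions \<open>x \<mapsto> min 1 (n * infdist x (- U))\<close>,
  so integrals of continuous functions fix the measures of open sets, which generate.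
\<close>

lemma borel_prob_on_eqI:
  fixes \<mu> \<mu>' :: "'x::metric_space measure"
  assumes \<mu>: "borel_prob_on Y \<mu>" and \<mu>': "borel_prob_on Y \<mu>'"
    and eq: "\<And>\<psi> :: 'x \<Rightarrow> real. continuous_on UNIV \<psi> \<Longrightarrow> (\<integral>x. \<psi> x \<partial>\<mu>) = (\<integral>x. \<psi> x \<partial>\<mu>')"
  shows "\<mu> = \<mu>'"
proof -
  have open_eq: "measure m (U \<inter> Y) = lim (\<lambda>n. \<integral>x. min 1 (real n * infdist x (- U)) \<partial>m)"
    if m: "borel_prob_on Y m" and U: "open U" "U \<noteq> UNIV" for m and U :: "'x set"
  proof -
    interpret prob_space m using m by (simp add: borel_prob_on_def)
    have "(\<lambda>n. \<integral>x. min 1 (real n * infdist x (- U)) \<partial>m) \<longlonglongrightarrow> (\<integral>x. indicator U x \<partial>m)"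
    proof (rule integral_dominated_convergence[where w="\<lambda>_. 1"])
      show "indicator U \<in> borel_measurable m"
        using U by (intro borel_prob_on_measurable_borel[OF m]) simp
      show "(\<lambda>x. min 1 (real n * infdist x (- U))) \<in> borel_measurable m" for n
        by (intro borel_prob_on_measurable_borel[OF m] borel_measurable_continuous_onI continuous_intros)
      have "(\<lambda>n. min 1 (real n * infdist x (- U))) \<longlonglongrightarrow> indicator U x" for x
      proof (cases "x \<in> U")
        case True
        then have pos: "infdist x (- U) > 0"
          using U infdist_pos_not_in_closed[of "- U" x] by auto
        have "\<forall>\<^sub>F n in sequentially. min 1 (real n * infdist x (- U)) = 1"
        proof -
          obtain N :: nat where N: "1 / infdist x (- U) < real N" using reals_Archimedean2 by blast
          show ?thesis
            unfolding eventually_sequentially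
          proof (intro exI allI impI)
            fix n assume "N \<le> n"
            then have "1 / infdist x (- U) \<le> real n" using N by linarith
            then show "min 1 (real n * infdist x (- U)) = 1"
              using pos by (simp add: field_simps)
          qed
        qed
        then show ?thesis using True by (simp add: tendsto_eventually)
      qed (simp add: infdist_zero)
      then show "AE x in m. (\<lambda>n. min 1 (real n * infdist x (- U))) \<longlonglongrightarrow> indicator U x" by simp
      show "AE x in m. norm (min 1 (real n * infdist x (- U))) \<le> 1" for n
        by (intro AE_I2) (simp add: infdist_nonneg)
    qed simp
    then show ?thesis
      by (simp add: limI borel_prob_on_space[OF m])
  qed
  have eqU: "measure \<mu> (U \<inter> Y) = measure \<mu>' (U \<inter> Y)" if U: "open U" for U
  proof (cases "U = UNIV")
    case True
    then show ?thesis
      using \<mu> \<mu>' prob_space.prob_space[of \<mu>] prob_space.prob_space[of \<mu>']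
        borel_prob_on_space[OF \<mu>] borel_prob_on_space[OF \<mu>'] by (simp add: borel_prob_on_def)
  next
    case False
    have "(\<integral>x. min 1 (real n * infdist x (- U)) \<partial>\<mu>) = (\<integral>x. min 1 (real n * infdist x (- U)) \<partial>\<mu>')" for n
      by (intro eq continuous_intros)
    then show ?thesis using open_eq[OF \<mu> U False] open_eq[OF \<mu>' U False] by simp
  qed
  have idm: "(\<lambda>x. x) \<in> measurable m borel" if "borel_prob_on Y m" for m
    by (rule borel_prob_on_measurable_borel[OF that]) simp
  have "distr \<mu> borel (\<lambda>x. x) = distr \<mu>' borel (\<lambda>x. x)"
  proof (rule measure_eqI_generator_eq[where E="Collect open" and \<Omega>=UNIV and A="\<lambda>_. UNIV"])
    show "emeasure (distr \<mu> borel (\<lambda>x. x)) UNIV \<noteq> \<infinity>"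
      using prob_space.emeasure_space_1[of \<mu>] \<mu> by (simp add: emeasure_distr idm[OF \<mu>] borel_prob_on_def)
    interpret P: prob_space \<mu> using \<mu> by (simp add: borel_prob_on_def)
    interpret P': prob_space \<mu>' using \<mu>' by (simp add: borel_prob_on_def)
    fix X :: "'x set" assume "X \<in> Collect open"
    then have "open X" by simp
    then show "emeasure (distr \<mu> borel (\<lambda>x. x)) X = emeasure (distr \<mu>' borel (\<lambda>x. x)) X"
      using eqU[OF \<open>open X\<close>]
      by (simp add: emeasure_distr idm[OF \<mu>] idm[OF \<mu>'] borel_prob_on_space[OF \<mu>] borel_prob_on_space[OF \<mu>']
          P.emeasure_eq_measure P'.emeasure_eq_measure)
  qed (auto simp: Int_stable_def borel_def)
  then have *: "emeasure \<mu> (X \<inter> Y) = emeasure \<mu>' (X \<inter> Y)" if "X \<in> sets borel" for X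
    using that emeasure_distr[OF idm[OF \<mu>] that] emeasure_distr[OF idm[OF \<mu>'] that]
      borel_prob_on_space[OF \<mu>] borel_prob_on_space[OF \<mu>'] by simp
  show ?thesis
  proof (rule measure_eqI)
    show "sets \<mu> = sets \<mu>'" using \<mu> \<mu>' by (simp add: borel_prob_on_def)
    fix X assume "X \<in> sets \<mu>"
    then obtain Z where "Z \<in> sets borel" "X = Z \<inter> Y"
      using \<mu> by (auto simp: borel_prob_on_def sets_restrict_space)
    then show "emeasure \<mu> X = emeasure \<mu>' X" using * by simp
  qed
qed

lemma sets_pair_borel_prob_on:
  fixes Y :: "'x::second_countable_topology set" and Z :: "'y::second_countable_topology set"
  assumes "borel_prob_on Y \<mu>" "borel_prob_on Z \<mu>'"
  shows "sets (\<mu> \<Otimes>\<^sub>M \<mu>') = sets (restrict_space borel (Y \<times> Z))"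
proof
  have [simp]: "sets \<mu> = sets (restrict_space borel Y)" "sets \<mu>' = sets (restrict_space borel Z)"
    using assms by (auto simp: borel_prob_on_def)
  note sp [simp] = borel_prob_on_space[OF assms(1)] borel_prob_on_space[OF assms(2)]
  have "fst \<in> measurable (\<mu> \<Otimes>\<^sub>M \<mu>') borel" "snd \<in> measurable (\<mu> \<Otimes>\<^sub>M \<mu>') borel"
    using measurable_compose[OF measurable_fst borel_prob_on_measurable_borel[OF assms(1) measurable_ident]]
      measurable_compose[OF measurable_snd borel_prob_on_measurable_borel[OF assms(2) measurable_ident]]
    by (simp_all add: id_def)
  then have id: "(\<lambda>p. p) \<in> measurable (\<mu> \<Otimes>\<^sub>M \<mu>') (borel :: ('x \<times> 'y) measure)"
    by (simp add: borel_prod[symmetric] measurable_pair_iff o_def)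
  show "sets (restrict_space borel (Y \<times> Z)) \<subseteq> sets (\<mu> \<Otimes>\<^sub>M \<mu>')"
    using measurable_sets[OF id] by (auto simp: sets_restrict_space space_pair_measure Int_commute)
  show "sets (\<mu> \<Otimes>\<^sub>M \<mu>') \<subseteq> sets (restrict_space borel (Y \<times> Z))"
  proof (rule sets_pair_in_sets)
    fix a b assume "a \<in> sets \<mu>" "b \<in> sets \<mu>'"
    then obtain X X' where *: "X \<in> sets borel" "X' \<in> sets borel" "a = Y \<inter> X" "b = Z \<inter> X'"
      by (auto simp: sets_restrict_space)
    then have "a \<times> b = (Y \<times> Z) \<inter> (X \<times> X')" by auto
    moreover have "X \<times> X' \<in> sets (borel :: ('x \<times> 'y) measure)"
      using * by (simp add: borel_prod[symmetric])
    ultimately show "a \<times> b \<in> sets (restrict_space borel (Y \<times> Z))"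
      by (auto simp: sets_restrict_space)
  qed
qed


section \<open>A subshift and its transpose\<close>

text \<open>
  Exchanging the arguments of \<open>A\<close> turns the subshift into its transpose and conversely, so that a statement about one
  side yields its mirror image.  As rewrite rules these identities terminate only for a fixed \<open>A\<close>.
\<close>

lemma subshift_flip: "subshift (\<lambda>a b. A b a) I = transpose_subshift A I"
  by (simp add: subshift_def transpose_subshift_def)

lemma transpose_subshift_flip: "transpose_subshift (\<lambda>a b. A b a) I = subshift A I"
  by (simp add: subshift_def transpose_subshift_def)

lemma sect_flip: "sect (\<lambda>a b. A b a) I = sect_star A I"
  by (simp add: sect_def sect_star_def fun_eq_iff)

lemma sect_star_flip: "sect_star (\<lambda>a b. A b a) I = sect A I"
  by (simp add: sect_def sect_star_def fun_eq_iff)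

lemma bi_kernel_flip: "bi_kernel (\<lambda>a b. A b a) I (\<lambda>(x, y). W (y, x)) c x y = bi_kernel A I W c y x"
  by (simp add: bi_kernel_def)

lemmas flip_simps = subshift_flip transpose_subshift_flip sect_flip sect_star_flip bi_kernel_flip

lemma case_nat_in_subshift: "case_nat a x \<in> subshift A I \<longleftrightarrow> x \<in> subshift A I \<and> a \<in> sect A I (x 0)"
  by (auto simp: subshift_def sect_def split: nat.splits)

lemma case_nat_in_transpose_subshift:
  "case_nat a y \<in> transpose_subshift A I \<longleftrightarrow> y \<in> transpose_subshift A I \<and> a \<in> sect_star A I (y 0)"
  using case_nat_in_subshift[of a y "\<lambda>a b. A b a" I] by (simp only: flip_simps[where A=A])

lemma shift_in_subshift: "x \<in> subshift A I \<Longrightarrow> shift x \<in> subshift A I"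
  by (simp add: subshift_def shift_def)

lemma head_in_sect: "x \<in> subshift A I \<Longrightarrow> x 0 \<in> sect A I (shift x 0)"
  by (simp add: subshift_def shift_def sect_def)

locale compact_alphabet =
  fixes A :: "'a::{metric_space, second_countable_topology} \<Rightarrow> 'a \<Rightarrow> real"
    and I :: "real set" and \<nu> :: "'a measure"
  assumes M_compact: "compact (UNIV :: 'a set)"
    and A_cont: "continuous_on UNIV (\<lambda>(a, b). A a b)"
    and I_closed: "closed I"
    and \<nu>: "borel_prob_on UNIV \<nu>"
begin

lemmas flips = flip_simps[where A=A]

lemma flipped_alphabet: "compact_alphabet (\<lambda>a b. A b a) I \<nu>"
proof -
  have "continuous_on UNIV (\<lambda>(a, b). A b a)"
    using continuous_on_compose2[OF A_cont, of UNIV prod.swap] by (simp add: case_prod_unfold continuous_on_swap)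
  then show ?thesis
    unfolding compact_alphabet_def using M_compact I_closed \<nu> by blast
qed

lemma prob_\<nu>: "prob_space \<nu>"
  using \<nu> by (simp add: borel_prob_on_def)

lemma sets_\<nu>: "open U \<Longrightarrow> U \<in> sets \<nu>"
  using \<nu> by (simp add: borel_prob_on_def sets_restrict_space_iff)

lemma A_cont_compose:
  assumes "continuous_on S f" "continuous_on S g"
  shows "continuous_on S (\<lambda>z. A (f z) (g z))"
  using continuous_on_compose2[OF A_cont continuous_on_Pair[OF assms]] by simp

lemma closed_sect: "closed (sect A I b)"
proof -
  have "closed ((\<lambda>a. A a b) -` I)"
    by (intro closed_vimage I_closed A_cont_compose continuous_intros)
  then show ?thesis by (simp add: sect_def vimage_def)
qed

lemma compact_sect: "compact (sect A I b)"
  using compact_Int_closed[OF M_compact closed_sect] by simp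

lemma closed_subshift: "closed (subshift A I)"
proof -
  have "subshift A I = (\<Inter>n. (\<lambda>x. A (x n) (x (Suc n))) -` I)"
    by (auto simp: subshift_def)
  then show ?thesis
    by (auto intro!: closed_INT closed_vimage I_closed A_cont_compose continuous_on_product_coordinates)
qed

lemma compact_subshift: "compact (subshift A I)"
  by (rule closed_imp_compact_seq[OF M_compact closed_subshift])

lemma closed_transpose: "closed (transpose_subshift A I)"
  using compact_alphabet.closed_subshift[OF flipped_alphabet] by (simp only: flips)

lemma compact_transpose: "compact (transpose_subshift A I)"
  using compact_alphabet.compact_subshift[OF flipped_alphabet] by (simp only: flips)

lemma continuous_on_case_nat_compose:
  assumes "x \<in> subshift A I" "continuous_on (subshift A I) g"
  shows "continuous_on (sect A I (x 0)) (\<lambda>a. g (case_nat a x))"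
  by (rule continuous_on_compose2[OF assms(2) continuous_on_case_nat])
    (auto simp: case_nat_in_subshift assms(1))

lemma ruelle_integrable:
  fixes g :: "(nat \<Rightarrow> 'a) \<Rightarrow> real"
  assumes "x \<in> subshift A I" "continuous_on (subshift A I) u" "continuous_on (subshift A I) g"
  shows "set_integrable \<nu> (sect A I (x 0)) (\<lambda>a. exp (u (case_nat a x)) *\<^sub>R g (case_nat a x))"
  unfolding set_integrable_def
  using borel_prob_on_integrable_indicator[OF \<nu> compact_sect, of "x 0" "\<lambda>a. exp (u (case_nat a x)) *\<^sub>R g (case_nat a x)"]
  by (simp add: continuous_intros continuous_on_case_nat_compose[OF assms(1)] assms(2,3))

end

text \<open>
  The setting in which both sides play the same role: the sections are nonempty and, with a
  common radius \<open>\<delta>\<close>, constant near the first entry of every sequence.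
\<close>

locale subshift_pair = compact_alphabet A I \<nu>
  for A :: "'a::{metric_space, second_countable_topology} \<Rightarrow> 'a \<Rightarrow> real"
    and I :: "real set" and \<nu> :: "'a measure" +
  fixes \<delta> :: real
  assumes \<delta>: "\<delta> > 0"
    and sect_const: "x \<in> subshift A I \<Longrightarrow> dist (x 0) b < \<delta> \<Longrightarrow> sect A I b = sect A I (x 0)"
    and sect_star_const: "y \<in> transpose_subshift A I \<Longrightarrow> dist (y 0) b < \<delta> \<Longrightarrow> sect_star A I b = sect_star A I (y 0)"
    and sect_nonempty: "x \<in> subshift A I \<Longrightarrow> sect A I (x 0) \<noteq> {}"
    and sect_star_nonempty: "y \<in> transpose_subshift A I \<Longrightarrow> sect_star A I (y 0) \<noteq> {}"
begin

lemma flipped: "subshift_pair (\<lambda>a b. A b a) I \<nu> \<delta>"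
  using flipped_alphabet \<delta> sect_const sect_star_const sect_nonempty sect_star_nonempty
  unfolding subshift_pair_def subshift_pair_axioms_def flips by blast

text \<open>Prepending symbols forever extends a point of the subshift to the left.\<close>

lemma extend_left:
  assumes "x \<in> subshift A I"
  shows "\<exists>y\<in>transpose_subshift A I. y 0 = x 0"
proof -
  have "\<exists>w. \<forall>n. (w n \<in> subshift A I \<and> (n = 0 \<longrightarrow> w n = x)) \<and> A (w (Suc n) 0) (w n 0) \<in> I"
  proof (rule dependent_nat_choice)
    fix z and n :: nat assume z: "z \<in> subshift A I \<and> (n = 0 \<longrightarrow> z = x)"
    then obtain a where "a \<in> sect A I (z 0)" using sect_nonempty by blast
    then show "\<exists>z'. (z' \<in> subshift A I \<and> (Suc n = 0 \<longrightarrow> z' = x)) \<and> A (z' 0) (z 0) \<in> I"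
      using z by (intro exI[of _ "case_nat a z"]) (simp add: case_nat_in_subshift sect_def)
  qed (use assms in auto)
  then obtain w where "\<forall>n. (w n \<in> subshift A I \<and> (n = 0 \<longrightarrow> w n = x)) \<and> A (w (Suc n) 0) (w n 0) \<in> I" ..
  then show ?thesis
    by (intro bexI[of _ "\<lambda>n. w n 0"]) (auto simp: transpose_subshift_def)
qed

lemma extend_right:
  assumes "y \<in> transpose_subshift A I"
  shows "\<exists>x\<in>subshift A I. x 0 = y 0"
  using subshift_pair.extend_left[OF flipped] assms by (simp only: flips)

lemma extend_right_strict:
  assumes "y \<in> transpose_subshift A I"
  shows "\<exists>x\<in>subshift A I. A (y 0) (x 0) \<in> I"
proof -
  obtain a where "a \<in> sect_star A I (y 0)" using sect_star_nonempty[OF assms] by blast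
  with extend_right[of "case_nat a y"] assms show ?thesis
    by (auto simp: case_nat_in_transpose_subshift sect_star_def)
qed

text \<open>
  Only finitely many sections occur on the subshift, so finitely many points of the subshift
  suffice to continue every point of the transpose.
\<close>

lemma finite_continuations:
  obtains F where "finite F" "F \<subseteq> subshift A I"
    "\<And>y. y \<in> transpose_subshift A I \<Longrightarrow> \<exists>x\<in>F. A (y 0) (x 0) \<in> I"
proof -
  have "open {z. dist (x 0) (z 0) < \<delta>}" for x :: "nat \<Rightarrow> 'a"
    by (intro open_Collect_less continuous_intros continuous_on_product_coordinates)
  then obtain F where F: "F \<subseteq> subshift A I" "finite F" "subshift A I \<subseteq> (\<Union>x\<in>F. {z. dist (x 0) (z 0) < \<delta>})"
    using compactE_image[OF compact_subshift, of "subshift A I" "\<lambda>x. {z. dist (x 0) (z 0) < \<delta>}"] \<delta> by force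
  have "\<exists>x\<in>F. A (y 0) (x 0) \<in> I" if y: "y \<in> transpose_subshift A I" for y
  proof -
    obtain z where z: "z \<in> subshift A I" "A (y 0) (z 0) \<in> I" using extend_right_strict[OF y] by blast
    then obtain x where "x \<in> F" "dist (x 0) (z 0) < \<delta>" using F by blast
    then show ?thesis using sect_const[of x "z 0"] F(1) z by (auto simp: sect_def)
  qed
  then show ?thesis using that F by blast
qed

end


section \<open>Potentials linked by a transfer function\<close>

lemma exp_diff_le:
  fixes u v Q :: real
  assumes "u \<le> Q" "v \<le> Q"
  shows "\<bar>exp u - exp v\<bar> \<le> exp Q * \<bar>u - v\<bar>"
proof -
  have "exp u - exp v \<le> exp Q * \<bar>u - v\<bar>" if "u \<le> Q" for u v
  proof -
    have "exp u - exp v = exp u * (1 - exp (v - u))" by (simp add: algebra_simps exp_add[symmetric])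
    also have "\<dots> \<le> exp u * \<bar>u - v\<bar>"
      using exp_ge_add_one_self[of "v - u"] by (intro mult_left_mono) (linarith, simp)
    also have "\<dots> \<le> exp Q * \<bar>u - v\<bar>" using that by (intro mult_right_mono) auto
    finally show ?thesis .
  qed
  from this[OF assms(1), of v] this[OF assms(2), of u] show ?thesis by (simp add: abs_minus_commute)
qed

lemma pair_dist_swap: "pair_dist (prod.swap p) (prod.swap q) = pair_dist p q"
  by (simp add: pair_dist_def)

locale linked_potentials = subshift_pair A I \<nu> \<delta>
  for A :: "'a::{metric_space, second_countable_topology} \<Rightarrow> 'a \<Rightarrow> real"
    and I :: "real set" and \<nu> :: "'a measure" and \<delta> :: real +
  fixes \<alpha> :: real and \<phi> \<phi>s :: "(nat \<Rightarrow> 'a) \<Rightarrow> real" and W :: "(nat \<Rightarrow> 'a) \<times> (nat \<Rightarrow> 'a) \<Rightarrow> real"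
  assumes \<alpha>: "\<alpha> > 0"
    and \<phi>: "hoelder_on seq_dist \<alpha> (subshift A I) \<phi>"
    and W: "hoelder_on pair_dist \<alpha> (bilateral_subshift A I) W"
    and \<phi>s: "hoelder_on seq_dist \<alpha> (transpose_subshift A I) \<phi>s"
    and link: "\<And>y x. (y, x) \<in> bilateral_subshift A I \<Longrightarrow>
      \<phi>s y = \<phi> (tau y x) + W (shift y, tau y x) - W (y, x)"
begin

lemma flipped_potentials: "linked_potentials (\<lambda>a b. A b a) I \<nu> \<delta> \<alpha> \<phi>s \<phi> (\<lambda>(x, y). W (y, x))"
proof -
  interpret F: subshift_pair "\<lambda>a b. A b a" I \<nu> \<delta> by (rule flipped)
  have bil: "(x, y) \<in> bilateral_subshift (\<lambda>a b. A b a) I \<longleftrightarrow> (y, x) \<in> bilateral_subshift A I" for x y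
    by (auto simp: bilateral_subshift_def flips)
  show ?thesis
  proof (unfold_locales, unfold flips)
    obtain C where "C \<ge> 0" and C: "\<forall>p\<in>bilateral_subshift A I. \<forall>q\<in>bilateral_subshift A I.
        norm (W p - W q) \<le> C * pair_dist p q powr \<alpha>"
      using W unfolding hoelder_on_def by blast
    show "hoelder_on pair_dist \<alpha> (bilateral_subshift (\<lambda>a b. A b a) I) (\<lambda>(x, y). W (y, x))"
      unfolding hoelder_on_def
    proof (intro exI[of _ C] conjI ballI \<open>C \<ge> 0\<close>)
      fix p q assume "p \<in> bilateral_subshift (\<lambda>a b. A b a) I" "q \<in> bilateral_subshift (\<lambda>a b. A b a) I"
      then have "prod.swap p \<in> bilateral_subshift A I" "prod.swap q \<in> bilateral_subshift A I"
        using bil[of "fst p" "snd p"] bil[of "fst q" "snd q"] by (simp_all add: prod.swap_def)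
      then have "norm (W (prod.swap p) - W (prod.swap q)) \<le> C * pair_dist p q powr \<alpha>"
        using C pair_dist_swap[of p q] by metis
      then show "norm ((case p of (x, y) \<Rightarrow> W (y, x)) - (case q of (x, y) \<Rightarrow> W (y, x))) \<le> C * pair_dist p q powr \<alpha>"
        by (simp add: case_prod_unfold prod.swap_def)
    qed
    fix x y assume "(x, y) \<in> bilateral_subshift (\<lambda>a b. A b a) I"
    then have xy: "y \<in> transpose_subshift A I" "x \<in> subshift A I" "A (y 0) (x 0) \<in> I"
      by (auto simp: bilateral_subshift_def flips)
    \<comment> \<open>Move the first entry of \<open>x\<close> to the other side of the bar.\<close>
    have "(case_nat (x 0) y, shift x) \<in> bilateral_subshift A I"
      using xy shift_in_subshift[OF xy(2)] head_in_sect[OF xy(2)]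
      by (auto simp: bilateral_subshift_def case_nat_in_transpose_subshift sect_star_def sect_def)
    from link[OF this]
    show "\<phi> x = \<phi>s (tau x y) + (case (shift x, tau x y) of (x, y) \<Rightarrow> W (y, x)) - (case (x, y) of (x, y) \<Rightarrow> W (y, x))"
      by (simp add: tau_def)
  qed (fact \<alpha> \<phi> \<phi>s)+
qed

lemma continuous_potential: "continuous_on (subshift A I) \<phi>"
  by (rule hoelder_on_imp_continuous_on[OF M_compact \<alpha> \<phi>])

abbreviation kernel :: "real \<Rightarrow> (nat \<Rightarrow> 'a) \<Rightarrow> (nat \<Rightarrow> 'a) \<Rightarrow> real" where
  "kernel c y x \<equiv> bi_kernel A I W c y x"

lemma kernel_nonneg: "kernel c y x \<ge> 0"
  by (simp add: bi_kernel_def)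

lemma W_bounded:
  obtains Q where "\<And>p. p \<in> bilateral_subshift A I \<Longrightarrow> \<bar>W p\<bar> \<le> Q"
proof (cases "bilateral_subshift A I = {}")
  case False
  then obtain q where q: "q \<in> bilateral_subshift A I" by blast
  obtain D where D: "D > 0" "\<And>x y :: nat \<Rightarrow> 'a. seq_dist x y \<le> D"
    using seq_dist_bounded[OF M_compact] by blast
  obtain C where "C \<ge> 0" and C: "\<forall>p\<in>bilateral_subshift A I. \<forall>q\<in>bilateral_subshift A I.
      norm (W p - W q) \<le> C * pair_dist p q powr \<alpha>"
    using W unfolding hoelder_on_def by blast
  have "\<bar>W p\<bar> \<le> \<bar>W q\<bar> + C * (D + D) powr \<alpha>" if p: "p \<in> bilateral_subshift A I" for p
  proof -
    have "\<bar>W p - W q\<bar> \<le> C * pair_dist p q powr \<alpha>" using C p q by simp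
    also have "\<dots> \<le> C * (D + D) powr \<alpha>"
      using D \<alpha> \<open>C \<ge> 0\<close> unfolding pair_dist_def
      by (intro mult_left_mono powr_mono2 add_mono add_nonneg_nonneg) (auto simp: seq_dist_nonneg[OF M_compact])
    finally show ?thesis by linarith
  qed
  then show ?thesis by (rule that)
qed (use that in auto)

lemma kernel_bounded:
  obtains Q where "Q > 0" "\<And>y x. y \<in> transpose_subshift A I \<Longrightarrow> x \<in> subshift A I \<Longrightarrow> kernel c y x \<le> Q"
proof -
  obtain Q where Q: "\<And>p. p \<in> bilateral_subshift A I \<Longrightarrow> \<bar>W p\<bar> \<le> Q" using W_bounded by blast
  have "kernel c y x \<le> exp (Q - c)" if "y \<in> transpose_subshift A I" "x \<in> subshift A I" for y x
    using Q[of "(y, x)"] that by (auto simp: bi_kernel_def bilateral_subshift_def indicator_def)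
  then show ?thesis by (intro that[of "exp (Q - c)"]) simp_all
qed

text \<open>
  For near \<open>x\<close> and \<open>x'\<close> the indicators agree and \<open>W\<close> governs the difference; otherwise
  \<open>seq_dist x x' \<ge> \<delta> / 2\<close> and a bound on the kernel suffices.
\<close>

lemma kernel_hoelder:
  "\<exists>C\<ge>0. \<forall>y\<in>transpose_subshift A I. \<forall>x\<in>subshift A I. \<forall>x'\<in>subshift A I.
     \<bar>kernel c y x - kernel c y x'\<bar> \<le> C * seq_dist x x' powr \<alpha>"
proof -
  obtain Q where Q: "\<And>p. p \<in> bilateral_subshift A I \<Longrightarrow> \<bar>W p\<bar> \<le> Q" using W_bounded by blast
  obtain R where R: "R > 0" "\<And>y x. y \<in> transpose_subshift A I \<Longrightarrow> x \<in> subshift A I \<Longrightarrow> kernel c y x \<le> R"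
    using kernel_bounded by blast
  obtain C where "C \<ge> 0" and C: "\<forall>p\<in>bilateral_subshift A I. \<forall>q\<in>bilateral_subshift A I.
      norm (W p - W q) \<le> C * pair_dist p q powr \<alpha>"
    using W unfolding hoelder_on_def by blast
  let ?C = "exp (Q - c) * C + R / (\<delta> / 2) powr \<alpha>"
  have pos: "(\<delta> / 2) powr \<alpha> > 0" using \<delta> by simp
  show ?thesis
  proof (intro exI[of _ ?C] conjI ballI)
    show "?C \<ge> 0" using \<open>C \<ge> 0\<close> R pos by (intro add_nonneg_nonneg mult_nonneg_nonneg divide_nonneg_pos) auto
    fix y x x' assume y: "y \<in> transpose_subshift A I" and x: "x \<in> subshift A I" and x': "x' \<in> subshift A I"
    have nn: "exp (Q - c) * C * seq_dist x x' powr \<alpha> \<ge> 0" "R / (\<delta> / 2) powr \<alpha> * seq_dist x x' powr \<alpha> \<ge> 0"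
      using \<open>C \<ge> 0\<close> R pos by (auto intro!: mult_nonneg_nonneg divide_nonneg_pos)
    show "\<bar>kernel c y x - kernel c y x'\<bar> \<le> ?C * seq_dist x x' powr \<alpha>"
    proof (cases "dist (x 0) (x' 0) < \<delta>")
      case True
      have same: "A (y 0) (x' 0) \<in> I \<longleftrightarrow> A (y 0) (x 0) \<in> I"
        using sect_const[OF x True] by (auto simp: sect_def)
      have "\<bar>kernel c y x - kernel c y x'\<bar> \<le> exp (Q - c) * C * seq_dist x x' powr \<alpha>"
      proof (cases "A (y 0) (x 0) \<in> I")
        case True
        then have b: "(y, x) \<in> bilateral_subshift A I" "(y, x') \<in> bilateral_subshift A I"
          using x x' y same by (auto simp: bilateral_subshift_def)
        have "\<bar>kernel c y x - kernel c y x'\<bar> = \<bar>exp (W (y, x) - c) - exp (W (y, x') - c)\<bar>"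
          using True same by (simp add: bi_kernel_def)
        also have "\<dots> \<le> exp (Q - c) * \<bar>W (y, x) - W (y, x')\<bar>"
          using exp_diff_le[of "W (y, x) - c" "Q - c" "W (y, x') - c"] Q[OF b(1)] Q[OF b(2)] by simp
        also have "\<dots> \<le> exp (Q - c) * (C * seq_dist x x' powr \<alpha>)"
          using C b by (intro mult_left_mono) (fastforce simp: pair_dist_def)+
        finally show ?thesis by simp
      qed (use same nn in \<open>simp add: bi_kernel_def\<close>)
      then show ?thesis using nn(2) by (simp add: distrib_right)
    next
      case False
      then have "\<delta> / 2 \<le> seq_dist x x'" using dist_head_le_seq_dist[OF M_compact, of x x'] by simp
      then have "(\<delta> / 2) powr \<alpha> \<le> seq_dist x x' powr \<alpha>" using \<delta> \<alpha> by (intro powr_mono2) auto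
      then have "R \<le> R / (\<delta> / 2) powr \<alpha> * seq_dist x x' powr \<alpha>"
        using R(1) pos by (simp add: field_simps)
      moreover have "\<bar>kernel c y x - kernel c y x'\<bar> \<le> R"
        using kernel_nonneg[of c y x] kernel_nonneg[of c y x'] R(2)[OF y x] R(2)[OF y x'] by linarith
      ultimately show ?thesis using nn(1) by (simp add: distrib_right)
    qed
  qed
qed

lemma kernel_continuous: "continuous_on (transpose_subshift A I \<times> subshift A I) (\<lambda>(y, x). kernel c y x)"
  unfolding continuous_on_def
proof
  interpret F: linked_potentials "\<lambda>a b. A b a" I \<nu> \<delta> \<alpha> \<phi>s \<phi> "\<lambda>(x, y). W (y, x)" by (rule flipped_potentials)
  fix p assume p: "p \<in> transpose_subshift A I \<times> subshift A I"
  let ?F = "at p within (transpose_subshift A I \<times> subshift A I)"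
  obtain C where C: "\<forall>y\<in>transpose_subshift A I. \<forall>x\<in>subshift A I. \<forall>x'\<in>subshift A I.
     \<bar>kernel c y x - kernel c y x'\<bar> \<le> C * seq_dist x x' powr \<alpha>"
    using kernel_hoelder by blast
  obtain C' where C': "\<forall>x\<in>subshift A I. \<forall>y\<in>transpose_subshift A I. \<forall>y'\<in>transpose_subshift A I.
     \<bar>kernel c y x - kernel c y' x\<bar> \<le> C' * seq_dist y y' powr \<alpha>"
    using F.kernel_hoelder[of c] unfolding flips by blast
  have t: "((\<lambda>q. seq_dist (g p) (g q)) \<longlongrightarrow> 0) ?F" if g: "isCont g p" for g :: "_ \<Rightarrow> nat \<Rightarrow> 'a"
  proof -
    have "((\<lambda>z. seq_dist (g p) z) \<longlongrightarrow> seq_dist (g p) (g p)) (at (g p))"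
      using tendsto_seq_dist_at[OF M_compact, of "g p" UNIV] by simp
    then show ?thesis
      using isCont_tendsto_compose[of "g p" "seq_dist (g p)" g ?F] continuous_at_imp_continuous_within[OF g]
      by (auto simp: continuous_within isCont_def)
  qed
  have lim: "((\<lambda>q. C * seq_dist (snd p) (snd q) powr \<alpha> + C' * seq_dist (fst p) (fst q) powr \<alpha>)
      \<longlongrightarrow> C * 0 + C' * 0) ?F"
    by (intro tendsto_add tendsto_mult_left tendsto_powr_zero t seq_dist_nonneg M_compact \<alpha> continuous_intros)
  have "\<forall>\<^sub>F q in ?F. norm ((\<lambda>(y, x). kernel c y x) q - (\<lambda>(y, x). kernel c y x) p)
      \<le> C * seq_dist (snd p) (snd q) powr \<alpha> + C' * seq_dist (fst p) (fst q) powr \<alpha>"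
    unfolding eventually_at_filter
  proof (intro always_eventually allI impI)
    fix q assume "q \<in> transpose_subshift A I \<times> subshift A I"
    then have "\<bar>kernel c (fst p) (snd p) - kernel c (fst p) (snd q)\<bar> \<le> C * seq_dist (snd p) (snd q) powr \<alpha>"
      "\<bar>kernel c (fst p) (snd q) - kernel c (fst q) (snd q)\<bar> \<le> C' * seq_dist (fst p) (fst q) powr \<alpha>"
      using C C' p by (auto simp: mem_Times_iff)
    then show "norm ((\<lambda>(y, x). kernel c y x) q - (\<lambda>(y, x). kernel c y x) p)
      \<le> C * seq_dist (snd p) (snd q) powr \<alpha> + C' * seq_dist (fst p) (fst q) powr \<alpha>"
      by (simp add: case_prod_unfold)
  qed
  then have "((\<lambda>q. (\<lambda>(y, x). kernel c y x) q - (\<lambda>(y, x). kernel c y x) p) \<longlongrightarrow> 0) ?F"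
    by (rule Lim_null_comparison) (use lim in simp)
  then show "((\<lambda>(y, x). kernel c y x) \<longlongrightarrow> (\<lambda>(y, x). kernel c y x) p) ?F" by (rule LIM_zero_cancel)
qed

lemma kernel_continuous_left:
  "x \<in> subshift A I \<Longrightarrow> continuous_on (transpose_subshift A I) (\<lambda>y. kernel c y x)"
  using continuous_on_compose2[OF kernel_continuous, of "transpose_subshift A I" "\<lambda>y. (y, x)"]
  by (simp add: continuous_intros image_subset_iff)

end


section \<open>Integration over products of subshifts\<close>

lemma borel_prob_on_pair:
  fixes Y :: "'x::second_countable_topology set" and Z :: "'y::second_countable_topology set"
  assumes "borel_prob_on Y \<mu>" "borel_prob_on Z \<mu>'"
  shows "borel_prob_on (Y \<times> Z) (\<mu> \<Otimes>\<^sub>M \<mu>')"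
proof -
  interpret P: pair_prob_space \<mu> \<mu>'
    using assms by (simp add: borel_prob_on_def pair_prob_space_def pair_sigma_finite_def prob_space_imp_sigma_finite)
  show ?thesis
    using P.prob_space_axioms sets_pair_borel_prob_on[OF assms] by (simp add: borel_prob_on_def)
qed

lemma borel_prob_on_Fubini:
  fixes f :: "'x \<Rightarrow> 'y \<Rightarrow> real"
  assumes "prob_space \<mu>" "prob_space \<mu>'" "integrable (\<mu> \<Otimes>\<^sub>M \<mu>') (\<lambda>(x, y). f x y)"
  shows "(\<integral>x. (\<integral>y. f x y \<partial>\<mu>') \<partial>\<mu>) = (\<integral>(x, y). f x y \<partial>(\<mu> \<Otimes>\<^sub>M \<mu>'))"
    and "(\<integral>y. (\<integral>x. f x y \<partial>\<mu>) \<partial>\<mu>') = (\<integral>(x, y). f x y \<partial>(\<mu> \<Otimes>\<^sub>M \<mu>'))"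
proof -
  interpret P: pair_sigma_finite \<mu> \<mu>'
    using assms by (simp add: pair_sigma_finite_def prob_space_imp_sigma_finite)
  show "(\<integral>x. (\<integral>y. f x y \<partial>\<mu>') \<partial>\<mu>) = (\<integral>(x, y). f x y \<partial>(\<mu> \<Otimes>\<^sub>M \<mu>'))"
    using P.integral_fst'[OF assms(3)] by simp
  then show "(\<integral>y. (\<integral>x. f x y \<partial>\<mu>) \<partial>\<mu>') = (\<integral>(x, y). f x y \<partial>(\<mu> \<Otimes>\<^sub>M \<mu>'))"
    using P.Fubini_integral[OF assms(3)] by simp
qed

lemma borel_prob_on_integral_pos:
  fixes g :: "'x::topological_space \<Rightarrow> real"
  assumes "borel_prob_on Y \<mu>" "integrable \<mu> g" "\<And>x. x \<in> Y \<Longrightarrow> g x > 0"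
  shows "(\<integral>x. g x \<partial>\<mu>) > 0"
proof -
  interpret prob_space \<mu> using assms(1) by (simp add: borel_prob_on_def)
  have nn: "AE x in \<mu>. 0 \<le> g x"
    using assms(3) by (intro AE_I2) (auto simp: borel_prob_on_space[OF assms(1)] less_imp_le)
  have "(\<integral>x. g x \<partial>\<mu>) \<noteq> 0"
  proof
    assume "(\<integral>x. g x \<partial>\<mu>) = 0"
    then have "AE x in \<mu>. g x = 0" using integral_nonneg_eq_0_iff_AE[OF assms(2) nn] by simp
    moreover have "AE x in \<mu>. g x \<noteq> 0"
      using assms(3) by (intro AE_I2) (auto simp: borel_prob_on_space[OF assms(1)] less_imp_neq[symmetric])
    ultimately have "AE x in \<mu>. False" by eventually_elim simp
    then show False by simp
  qed
  then show ?thesis using integral_nonneg_AE[OF nn] by linarith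
qed


section \<open>The Ruelle operator on continuous functions\<close>

context linked_potentials
begin

abbreviation transfer :: "((nat \<Rightarrow> 'a) \<Rightarrow> real) \<Rightarrow> (nat \<Rightarrow> 'a) \<Rightarrow> real" where
  "transfer \<equiv> ruelle \<nu> (sect A I) \<phi>"

lemma transfer_integrable:
  fixes g :: "(nat \<Rightarrow> 'a) \<Rightarrow> real"
  assumes "x \<in> subshift A I" "continuous_on (subshift A I) g"
  shows "set_integrable \<nu> (sect A I (x 0)) (\<lambda>a. exp (\<phi> (case_nat a x)) *\<^sub>R g (case_nat a x))"
  by (rule ruelle_integrable[OF assms(1) continuous_potential assms(2)])

lemma transfer_mono:
  assumes "x \<in> subshift A I" "continuous_on (subshift A I) g" "continuous_on (subshift A I) g'"
    and "\<And>z. z \<in> subshift A I \<Longrightarrow> g z \<le> g' z"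
  shows "transfer g x \<le> transfer g' x"
  unfolding ruelle_def
  by (intro set_integral_mono transfer_integrable assms)
    (auto intro!: mult_left_mono assms(4) simp: case_nat_in_subshift assms(1))

lemma transfer_cong:
  assumes "x \<in> subshift A I" "\<And>z. z \<in> subshift A I \<Longrightarrow> g z = g' z"
  shows "transfer g x = transfer g' x"
  unfolding ruelle_def set_lebesgue_integral_def
  by (intro Bochner_Integration.integral_cong refl)
    (auto simp: indicator_def case_nat_in_subshift assms)

text \<open>
  Every point over which the operator integrates is mapped to \<open>x\<close> by the shift, so functions of the shifted point are constant
  there and pull out.
\<close>

lemma transfer_shift_mult: "transfer (\<lambda>z. u (shift z) * g z) x = u x * transfer g x"
  unfolding ruelle_def by (subst set_integral_mult_right[symmetric]) (simp add: mult.left_commute)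

lemma transfer_mult: "transfer (\<lambda>z. k * g z) x = k * transfer g x"
  using transfer_shift_mult[of "\<lambda>_. k"] by simp

text \<open>Joint measurability in the point and the prepended symbol, followed by integration over the symbol.\<close>

lemma transfer_measurable:
  assumes "continuous_on (subshift A I) g" "borel_prob_on (subshift A I) \<mu>"
  shows "transfer g \<in> borel_measurable \<mu>"
proof -
  interpret N: prob_space \<nu> using \<nu> by (simp add: borel_prob_on_def)
  let ?S = "{(x, a). x \<in> subshift A I \<and> A a (x 0) \<in> I}"
  let ?G = "\<lambda>(x, a). exp (\<phi> (case_nat a x)) * g (case_nat a x)"
  have 0: "continuous_on UNIV (\<lambda>p::(nat \<Rightarrow> 'a) \<times> 'a. fst p 0)"
    by (rule continuous_on_product_then_coordinatewise[OF continuous_on_fst[OF continuous_on_id]])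
  have "closed ((subshift A I \<times> UNIV) \<inter> (\<lambda>p. A (snd p) (fst p 0)) -` I)"
    by (intro closed_Int closed_Times closed_subshift closed_UNIV closed_vimage I_closed A_cont_compose
        continuous_on_snd continuous_on_id 0)
  moreover have S: "?S = (subshift A I \<times> UNIV) \<inter> (\<lambda>p. A (snd p) (fst p 0)) -` I" by auto
  ultimately have "compact ((subshift A I \<times> UNIV) \<inter> ?S)"
    by (intro compact_Int_closed compact_Times compact_subshift M_compact) simp
  then have cS: "compact ?S" using S by (simp add: inf.absorb2)
  have cn: "continuous_on ?S (\<lambda>(x, a). case_nat a x)"
  proof (rule continuous_on_coordinatewise_then_product)
    show "continuous_on ?S (\<lambda>p. (case p of (x, a) \<Rightarrow> case_nat a x) n)" for n
    proof (cases n)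
      case (Suc m)
      then show ?thesis
        using continuous_on_product_then_coordinatewise[OF continuous_on_fst[OF continuous_on_id]]
        by (simp add: case_prod_unfold)
    qed (simp add: case_prod_unfold continuous_on_snd)
  qed
  have *: "continuous_on ?S (\<lambda>p. u (case p of (x, a) \<Rightarrow> case_nat a x))"
    if "continuous_on (subshift A I) u" for u :: "(nat \<Rightarrow> 'a) \<Rightarrow> real"
    by (rule continuous_on_compose2[OF that cn]) (auto simp: case_nat_in_subshift sect_def)
  have "continuous_on ?S ?G"
    using continuous_on_mult[OF continuous_on_exp[OF *[OF continuous_potential]] *[OF assms(1)]]
    by (simp add: case_prod_unfold)
  then have "integrable (\<mu> \<Otimes>\<^sub>M \<nu>) (\<lambda>p. indicator ?S p * ?G p)"
    by (intro borel_prob_on_integrable_indicator[OF borel_prob_on_pair[OF assms(2) \<nu>] cS])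
  then have "(\<lambda>(x, a). indicator ?S (x, a) * ?G (x, a)) \<in> borel_measurable (\<mu> \<Otimes>\<^sub>M \<nu>)"
    by (simp add: case_prod_unfold borel_measurable_integrable)
  then have "(\<lambda>x. \<integral>a. indicator ?S (x, a) * ?G (x, a) \<partial>\<nu>) \<in> borel_measurable \<mu>"
    by (rule N.borel_measurable_lebesgue_integral)
  then show ?thesis
    by (rule measurable_cong[THEN iffD1, rotated])
      (auto simp: ruelle_def set_lebesgue_integral_def borel_prob_on_space[OF assms(2)] sect_def indicator_def
        intro!: Bochner_Integration.integral_cong)
qed

end


section \<open>Eigenfunctions from the transposed eigenprobability\<close>

locale linked_eigendata = linked_potentials A I \<nu> \<delta> \<alpha> \<phi> \<phi>s W
  for A :: "'a::{metric_space, second_countable_topology} \<Rightarrow> 'a \<Rightarrow> real"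
    and I :: "real set" and \<nu> :: "'a measure" and \<delta> \<alpha> :: real
    and \<phi> \<phi>s :: "(nat \<Rightarrow> 'a) \<Rightarrow> real" and W :: "(nat \<Rightarrow> 'a) \<times> (nat \<Rightarrow> 'a) \<Rightarrow> real" +
  fixes l ls :: real and h hs :: "(nat \<Rightarrow> 'a) \<Rightarrow> real" and \<rho> \<rho>s :: "(nat \<Rightarrow> 'a) measure"
  assumes rpf: "rpf_data \<nu> \<alpha> (subshift A I) (sect A I) \<phi> l h \<rho>"
    and rpf_star: "rpf_data \<nu> \<alpha> (transpose_subshift A I) (sect_star A I) \<phi>s ls hs \<rho>s"
begin

lemma flipped_eigendata:
  "linked_eigendata (\<lambda>a b. A b a) I \<nu> \<delta> \<alpha> \<phi>s \<phi> (\<lambda>(x, y). W (y, x)) ls l hs h \<rho>s \<rho>"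
  using flipped_potentials rpf rpf_star
  unfolding linked_eigendata_def linked_eigendata_axioms_def flips by blast

lemma eigenprob: "borel_prob_on (subshift A I) \<rho>"
  and eigenprob_star: "borel_prob_on (transpose_subshift A I) \<rho>s"
  and l_pos: "l > 0"
  and h_pos: "x \<in> subshift A I \<Longrightarrow> h x > 0"
  and transfer_h: "x \<in> subshift A I \<Longrightarrow> transfer h x = l * h x"
  using rpf rpf_star by (auto simp: rpf_data_def)

lemma prob: "prob_space \<rho>" and prob_star: "prob_space \<rho>s"
  using eigenprob eigenprob_star by (auto simp: borel_prob_on_def)

lemma h_continuous: "continuous_on (subshift A I) h"
  using rpf by (auto simp: rpf_data_def intro: hoelder_on_imp_continuous_on[OF M_compact \<alpha>])

lemma integral_transfer:
  "continuous_on (subshift A I) g \<Longrightarrow> (\<integral>x. transfer g x \<partial>\<rho>) = l * (\<integral>x. g x \<partial>\<rho>)"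
  using rpf by (auto simp: rpf_data_def ruelle_dual_eq_def)

lemmas integrable_eigenprob = borel_prob_on_integrable_continuous(2)[OF eigenprob compact_subshift]
lemmas measurable_eigenprob = borel_prob_on_integrable_continuous(1)[OF eigenprob compact_subshift]

definition marginal :: "real \<Rightarrow> (nat \<Rightarrow> 'a) \<Rightarrow> real" where
  "marginal c x = (\<integral>y. kernel c y x \<partial>\<rho>s)"

lemma kernel_integrable: "x \<in> subshift A I \<Longrightarrow> integrable \<rho>s (\<lambda>y. kernel c y x)"
  by (intro borel_prob_on_integrable_continuous(2)[OF eigenprob_star compact_transpose] kernel_continuous_left)

lemma marginal_nonneg: "marginal c x \<ge> 0"
  unfolding marginal_def by (intro integral_nonneg_AE AE_I2 kernel_nonneg)

text \<open>Hoelder continuity makes the marginal eligible for the simplicity of the eigenvalue \<open>l\<close>.\<close>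

lemma marginal_hoelder: "hoelder_on seq_dist \<alpha> (subshift A I) (marginal c)"
proof -
  interpret S: prob_space \<rho>s by (rule prob_star)
  obtain C where "C \<ge> 0" and C: "\<forall>y\<in>transpose_subshift A I. \<forall>x\<in>subshift A I. \<forall>x'\<in>subshift A I.
     \<bar>kernel c y x - kernel c y x'\<bar> \<le> C * seq_dist x x' powr \<alpha>"
    using kernel_hoelder by blast
  show ?thesis
    unfolding hoelder_on_def
  proof (intro exI[of _ C] conjI ballI \<open>C \<ge> 0\<close>)
    fix x x' assume x: "x \<in> subshift A I" "x' \<in> subshift A I"
    have "norm (marginal c x - marginal c x') = norm (\<integral>y. kernel c y x - kernel c y x' \<partial>\<rho>s)"
      unfolding marginal_def by (subst Bochner_Integration.integral_diff) (auto intro: kernel_integrable x)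
    also have "\<dots> \<le> (\<integral>y. norm (kernel c y x - kernel c y x') \<partial>\<rho>s)" by (rule integral_norm_bound)
    also have "\<dots> \<le> (\<integral>y. C * seq_dist x x' powr \<alpha> \<partial>\<rho>s)"
      by (intro integral_mono integrable_norm Bochner_Integration.integrable_diff kernel_integrable x)
        (auto simp: borel_prob_on_space[OF eigenprob_star] C x)
    also have "\<dots> = C * seq_dist x x' powr \<alpha>" using S.prob_space by simp
    finally show "norm (marginal c x - marginal c x') \<le> C * seq_dist x x' powr \<alpha>" .
  qed
qed

lemma marginal_continuous: "continuous_on (subshift A I) (marginal c)"
  by (rule hoelder_on_imp_continuous_on[OF M_compact \<alpha> marginal_hoelder])

text \<open>
  For admissible words \<open>y a x\<close> the link between the potentials reads
  \<open>\<phi>s (y a) + W (y a | x) = \<phi> (a x) + W (y | a x)\<close>: moving \<open>a\<close> across the bar exchanges the two potentials.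
  Integrating this over \<open>a\<close> and \<open>y\<close> turns the operator acting on \<open>x\<close> into the transposed operator acting on \<open>y\<close>,
  and the latter is absorbed by its eigenprobability.
\<close>

lemma transfer_marginal:
  assumes x: "x \<in> subshift A I"
  shows "transfer (marginal c) x = ls * marginal c x"
proof -
  interpret F: linked_eigendata "\<lambda>a b. A b a" I \<nu> \<delta> \<alpha> \<phi>s \<phi> "\<lambda>(x, y). W (y, x)" ls l hs h \<rho>s \<rho>
    by (rule flipped_eigendata)
  let ?s = "sect A I (x 0)" and ?Bs = "transpose_subshift A I"
  let ?K = "\<lambda>a y. indicator ?s a * (exp (\<phi> (case_nat a x)) * kernel c y (case_nat a x))"
  have "continuous_on (?s \<times> ?Bs) (\<lambda>p. (\<lambda>(y, x). kernel c y x) (snd p, case_nat (fst p) x))"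
  proof (rule continuous_on_compose2[OF kernel_continuous])
    show "continuous_on (?s \<times> ?Bs) (\<lambda>p. (snd p, case_nat (fst p) x))"
      by (intro continuous_on_Pair continuous_on_snd continuous_on_id
          continuous_on_compose2[OF continuous_on_case_nat continuous_on_fst[OF continuous_on_id]]) auto
  qed (auto simp: case_nat_in_subshift x)
  moreover have "continuous_on (?s \<times> ?Bs) (\<lambda>p. \<phi> (case_nat (fst p) x))"
    by (rule continuous_on_compose2[OF continuous_on_case_nat_compose[OF x continuous_potential]])
      (auto intro: continuous_on_fst continuous_on_id)
  ultimately have "continuous_on (?s \<times> ?Bs) (\<lambda>(a, y). exp (\<phi> (case_nat a x)) * kernel c y (case_nat a x))"
    by (auto simp: case_prod_unfold intro!: continuous_on_mult continuous_on_exp)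
  then have "integrable (\<nu> \<Otimes>\<^sub>M \<rho>s)
      (\<lambda>p. indicator (?s \<times> ?Bs) p * (\<lambda>(a, y). exp (\<phi> (case_nat a x)) * kernel c y (case_nat a x)) p)"
    by (intro borel_prob_on_integrable_indicator[OF borel_prob_on_pair[OF \<nu> eigenprob_star]]
        compact_Times compact_sect compact_transpose)
  then have int: "integrable (\<nu> \<Otimes>\<^sub>M \<rho>s) (\<lambda>(a, y). ?K a y)"
    by (rule Bochner_Integration.integrable_cong[THEN iffD1, rotated 2])
      (auto simp: space_pair_measure borel_prob_on_space[OF eigenprob_star] indicator_def)
  have "transfer (marginal c) x = (\<integral>a. (\<integral>y. ?K a y \<partial>\<rho>s) \<partial>\<nu>)"
    by (simp add: ruelle_def set_lebesgue_integral_def marginal_def)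
  also have "\<dots> = (\<integral>y. (\<integral>a. ?K a y \<partial>\<nu>) \<partial>\<rho>s)"
    using borel_prob_on_Fubini[OF prob_\<nu> prob_star int] by simp
  also have "\<dots> = (\<integral>y. ruelle \<nu> (sect_star A I) \<phi>s (\<lambda>y. kernel c y x) y \<partial>\<rho>s)"
  proof (intro Bochner_Integration.integral_cong refl)
    fix y assume "y \<in> space \<rho>s"
    then have y: "y \<in> ?Bs" by (simp add: borel_prob_on_space[OF eigenprob_star])
    have "?K a y = indicator (sect_star A I (y 0)) a *\<^sub>R (exp (\<phi>s (case_nat a y)) *\<^sub>R kernel c (case_nat a y) x)" for a
    proof (cases "a \<in> ?s \<and> a \<in> sect_star A I (y 0)")
      case True
      then have "(case_nat a y, x) \<in> bilateral_subshift A I"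
        using x y by (auto simp: bilateral_subshift_def case_nat_in_transpose_subshift sect_def)
      from link[OF this] have "\<phi>s (case_nat a y) + W (case_nat a y, x) = \<phi> (case_nat a x) + W (y, case_nat a x)"
        by (simp add: tau_def)
      then have "exp (\<phi> (case_nat a x)) * exp (W (y, case_nat a x) - c)
          = exp (\<phi>s (case_nat a y)) * exp (W (case_nat a y, x) - c)"
        by (simp add: exp_add[symmetric])
      then show ?thesis using True by (simp add: bi_kernel_def sect_def sect_star_def)
    qed (auto simp: bi_kernel_def sect_def sect_star_def)
    then show "(\<integral>a. ?K a y \<partial>\<nu>) = ruelle \<nu> (sect_star A I) \<phi>s (\<lambda>y. kernel c y x) y"
      by (simp add: ruelle_def set_lebesgue_integral_def)
  qed
  also have "\<dots> = ls * marginal c x"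
    using F.integral_transfer[of "\<lambda>y. kernel c y x"] kernel_continuous_left[OF x]
    by (simp add: flips marginal_def)
  finally show ?thesis .
qed

text \<open>
  The kernels at the points of a finite set of continuations add up to a function that is strictly positive on the transpose,
  so its integral with respect to \<open>\<rho>s\<close> is positive.
\<close>

lemma marginal_positive_somewhere: "\<exists>x\<in>subshift A I. marginal c x > 0"
proof -
  obtain F where F: "finite F" "F \<subseteq> subshift A I"
    "\<And>y. y \<in> transpose_subshift A I \<Longrightarrow> \<exists>x\<in>F. A (y 0) (x 0) \<in> I"
    using finite_continuations by blast
  have "(\<Sum>x\<in>F. marginal c x) = (\<integral>y. (\<Sum>x\<in>F. kernel c y x) \<partial>\<rho>s)"
    unfolding marginal_def by (subst Bochner_Integration.integral_sum) (use F kernel_integrable in auto)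
  also have "\<dots> > 0"
  proof (rule borel_prob_on_integral_pos[OF eigenprob_star])
    show "integrable \<rho>s (\<lambda>y. \<Sum>x\<in>F. kernel c y x)"
      using F kernel_integrable by (intro Bochner_Integration.integrable_sum) auto
    fix y assume "y \<in> transpose_subshift A I"
    then obtain x where "x \<in> F" "A (y 0) (x 0) \<in> I" using F by blast
    then show "(\<Sum>x\<in>F. kernel c y x) > 0"
      using F(1) by (intro sum_pos2[of _ x] kernel_nonneg) (auto simp: bi_kernel_def)
  qed
  finally obtain x where "x \<in> F" "marginal c x > 0"
    by (metis not_le sum_nonpos)
  then show ?thesis using F by blast
qed

text \<open>
  Evaluate both eigenvalue equations at a point where \<open>marginal c / h\<close> is maximal: there
  positivity of the operator bounds the eigenvalue of \<open>marginal c\<close> by that of \<open>h\<close>.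
\<close>

lemma eigenvalue_star_le: "ls \<le> l"
proof -
  let ?B = "subshift A I" and ?m = "marginal 0"
  have "continuous_on ?B (\<lambda>x. ?m x / h x)"
    using h_pos by (intro continuous_on_divide marginal_continuous h_continuous) (metis less_irrefl)
  then obtain z where z: "z \<in> ?B" "\<And>x. x \<in> ?B \<Longrightarrow> ?m x / h x \<le> ?m z / h z"
    using continuous_attains_sup[OF compact_subshift borel_prob_on_nonempty[OF eigenprob]] by blast
  let ?C = "?m z / h z"
  have le: "?m x \<le> ?C * h x" if "x \<in> ?B" for x
    using z(2)[OF that] h_pos[OF that] by (simp add: pos_divide_le_eq)
  obtain x where "x \<in> ?B" "?m x > 0" using marginal_positive_somewhere by blast
  then have "?C * h x > 0" using le by fastforce
  then have "?C > 0" using h_pos[OF \<open>x \<in> ?B\<close>] zero_less_mult_pos2 by blast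
  then have pos: "?m z > 0" using h_pos[OF z(1)] by (simp add: zero_less_divide_iff)
  have "ls * ?m z = transfer ?m z" by (simp add: transfer_marginal z)
  also have "\<dots> \<le> transfer (\<lambda>x. ?C * h x) z"
    by (intro transfer_mono z le marginal_continuous continuous_on_mult continuous_on_const h_continuous)
  also have "\<dots> = l * ?m z"
    using h_pos[OF z(1)] by (subst transfer_mult) (simp add: transfer_h z)
  finally show ?thesis using pos by simp
qed

lemma eigenvalues_eq: "ls = l"
proof -
  interpret F: linked_eigendata "\<lambda>a b. A b a" I \<nu> \<delta> \<alpha> \<phi>s \<phi> "\<lambda>(x, y). W (y, x)" ls l hs h \<rho>s \<rho>
    by (rule flipped_eigendata)
  show ?thesis using eigenvalue_star_le F.eigenvalue_star_le by simp
qed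

lemma transfer_marginal': "x \<in> subshift A I \<Longrightarrow> transfer (marginal c) x = l * marginal c x"
  by (simp add: transfer_marginal eigenvalues_eq)

lemma marginal_proportional:
  obtains k where "k > 0" "\<And>x. x \<in> subshift A I \<Longrightarrow> marginal c x = k * h x"
proof -
  obtain k where k: "\<forall>x\<in>subshift A I. marginal c x = k * h x"
    using rpf marginal_hoelder transfer_marginal' unfolding rpf_data_def by meson
  obtain x where "x \<in> subshift A I" "marginal c x > 0" using marginal_positive_somewhere by blast
  then have "k > 0" using k h_pos[of x] by (simp add: zero_less_mult_iff)
  then show ?thesis using that k by blast
qed

lemma marginal_pos: "x \<in> subshift A I \<Longrightarrow> marginal c x > 0"
  by (rule marginal_proportional[of c]) (simp add: h_pos)

end


section \<open>The bilateral measure and its marginals\<close>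

context linked_eigendata
begin

lemma continuous_on_right:
  fixes \<psi> :: "(nat \<Rightarrow> 'a) \<Rightarrow> real"
  assumes "continuous_on (subshift A I) \<psi>"
  shows "continuous_on (transpose_subshift A I \<times> subshift A I) (\<lambda>(y, x). \<psi> x)"
  unfolding case_prod_unfold
  by (rule continuous_on_compose2[OF assms]) (auto intro: continuous_on_snd continuous_on_id)

lemma continuous_on_left:
  fixes \<psi> :: "(nat \<Rightarrow> 'a) \<Rightarrow> real"
  assumes "continuous_on (transpose_subshift A I) \<psi>"
  shows "continuous_on (transpose_subshift A I \<times> subshift A I) (\<lambda>(y, x). \<psi> y)"
  unfolding case_prod_unfold
  by (rule continuous_on_compose2[OF assms]) (auto intro: continuous_on_fst continuous_on_id)

lemma kernel_mult_integrable:
  assumes "continuous_on (transpose_subshift A I \<times> subshift A I) G"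
  shows "integrable (\<rho>s \<Otimes>\<^sub>M \<rho>) (\<lambda>(y, x). kernel c y x * G (y, x))"
  using borel_prob_on_integrable_continuous(2)[OF borel_prob_on_pair[OF eigenprob_star eigenprob]
      compact_Times[OF compact_transpose compact_subshift] continuous_on_mult[OF kernel_continuous assms]]
  by (simp add: case_prod_unfold)

lemma integral_kernel_marginal:
  fixes \<psi> :: "(nat \<Rightarrow> 'a) \<Rightarrow> real"
  assumes "continuous_on (subshift A I) \<psi>"
  shows "(\<integral>(y, x). kernel c y x * \<psi> x \<partial>(\<rho>s \<Otimes>\<^sub>M \<rho>)) = (\<integral>x. marginal c x * \<psi> x \<partial>\<rho>)"
proof -
  have "integrable (\<rho>s \<Otimes>\<^sub>M \<rho>) (\<lambda>(y, x). kernel c y x * \<psi> x)"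
    using kernel_mult_integrable[OF continuous_on_right[OF assms]] by simp
  from borel_prob_on_Fubini(2)[OF prob_star prob this] show ?thesis
    by (simp add: marginal_def)
qed

lemma integral_kernel_marginal_star:
  fixes \<psi> :: "(nat \<Rightarrow> 'a) \<Rightarrow> real"
  assumes "continuous_on (transpose_subshift A I) \<psi>"
  shows "(\<integral>(y, x). kernel c y x * \<psi> y \<partial>(\<rho>s \<Otimes>\<^sub>M \<rho>)) = (\<integral>y. (\<integral>x. kernel c y x \<partial>\<rho>) * \<psi> y \<partial>\<rho>s)"
proof -
  have "integrable (\<rho>s \<Otimes>\<^sub>M \<rho>) (\<lambda>(y, x). kernel c y x * \<psi> y)"
    using kernel_mult_integrable[OF continuous_on_left[OF assms]] by simp
  from borel_prob_on_Fubini(1)[OF prob_star prob this] show ?thesis by simp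
qed

abbreviation normalizer :: real where
  "normalizer \<equiv> bi_const A I W \<rho>s \<rho>"

abbreviation density_fun :: "(nat \<Rightarrow> 'a) \<Rightarrow> real" where
  "density_fun \<equiv> marginal normalizer"

lemma integral_density_fun: "(\<integral>x. density_fun x \<partial>\<rho>) = 1"
proof -
  have Z: "(\<integral>(y, x). kernel c y x \<partial>(\<rho>s \<Otimes>\<^sub>M \<rho>)) = (\<integral>x. marginal c x \<partial>\<rho>)" for c
    using integral_kernel_marginal[of "\<lambda>_. 1" c] by simp
  have pos: "(\<integral>x. marginal 0 x \<partial>\<rho>) > 0"
    by (intro borel_prob_on_integral_pos[OF eigenprob] integrable_eigenprob marginal_continuous marginal_pos)
  have "normalizer = ln (\<integral>x. marginal 0 x \<partial>\<rho>)"
    unfolding Z[symmetric] by (simp add: bi_const_def bi_kernel_def case_prod_unfold)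
  then have norm: "exp (- normalizer) * (\<integral>x. marginal 0 x \<partial>\<rho>) = 1"
    using pos by (simp add: exp_minus)
  have "kernel normalizer y x = exp (- normalizer) * kernel 0 y x" for y x
    by (simp add: bi_kernel_def exp_diff exp_minus divide_inverse)
  then have "density_fun = (\<lambda>x. exp (- normalizer) * marginal 0 x)"
    by (simp add: marginal_def[abs_def])
  then show ?thesis using norm by simp
qed

definition gibbs :: "(nat \<Rightarrow> 'a) measure" where
  "gibbs = density \<rho> (\<lambda>x. ennreal (density_fun x))"

lemma integral_gibbs:
  assumes "g \<in> borel_measurable \<rho>"
  shows "(\<integral>x. g x \<partial>gibbs) = (\<integral>x. density_fun x * g x \<partial>\<rho>)"
  unfolding gibbs_def
  by (rule integral_real_density) (auto intro: assms measurable_eigenprob marginal_continuous marginal_nonneg)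

lemma integral_gibbs_continuous:
  "continuous_on (subshift A I) g \<Longrightarrow> (\<integral>x. g x \<partial>gibbs) = (\<integral>x. density_fun x * g x \<partial>\<rho>)"
  by (intro integral_gibbs measurable_eigenprob)

lemma gibbs_prob: "borel_prob_on (subshift A I) gibbs"
proof -
  have "emeasure gibbs (space gibbs) = (\<integral>\<^sup>+x. ennreal (density_fun x) \<partial>\<rho>)"
    unfolding gibbs_def
    using measurable_eigenprob[OF marginal_continuous, of normalizer]
    by (simp add: emeasure_density cong: nn_integral_cong)
  also have "\<dots> = ennreal (\<integral>x. density_fun x \<partial>\<rho>)"
    by (intro nn_integral_eq_integral integrable_eigenprob marginal_continuous AE_I2 marginal_nonneg)
  finally have "prob_space gibbs" by (intro prob_spaceI) (simp add: integral_density_fun)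
  then show ?thesis using eigenprob by (simp add: borel_prob_on_def gibbs_def)
qed

text \<open>
  Up to the factor \<open>1 / (l h)\<close> the normalized operator is \<open>\<psi> \<mapsto> transfer (h \<psi>)\<close>, so \<open>h \<rho>\<close> is fixed by its dual;
  simplicity of \<open>l\<close> makes the marginal density a multiple of \<open>h\<close>.
\<close>

lemma gibbs_state_eq:
  assumes "gibbs_state \<nu> (subshift A I) (sect A I) \<phi> l h \<mu>"
  shows "\<mu> = gibbs"
proof -
  let ?B = "subshift A I"
  obtain k where k: "k > 0" "\<And>x. x \<in> ?B \<Longrightarrow> density_fun x = k * h x"
    using marginal_proportional by blast
  have "ruelle_dual_eq \<nu> ?B (sect A I) (normalized_potential \<phi> l h) 1 gibbs"
    unfolding ruelle_dual_eq_def
  proof (intro allI impI)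
    fix \<psi> :: "(nat \<Rightarrow> 'a) \<Rightarrow> real" assume \<psi>: "continuous_on ?B \<psi>"
    have h\<psi>: "continuous_on ?B (\<lambda>z. h z * \<psi> z)" by (intro continuous_on_mult h_continuous \<psi>)
    let ?R = "ruelle \<nu> (sect A I) (normalized_potential \<phi> l h) \<psi>"
    have R: "?R x = transfer (\<lambda>z. h z * \<psi> z) x / (l * h x)" if x: "x \<in> ?B" for x
    proof -
      have "?R x = transfer (\<lambda>z. 1 / (l * h (shift z)) * (h z * \<psi> z)) x"
        unfolding ruelle_def set_lebesgue_integral_def
      proof (intro Bochner_Integration.integral_cong refl)
        fix a
        show "indicator (sect A I (x 0)) a *\<^sub>R exp (normalized_potential \<phi> l h (case_nat a x)) *\<^sub>R \<psi> (case_nat a x)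
          = indicator (sect A I (x 0)) a *\<^sub>R exp (\<phi> (case_nat a x)) *\<^sub>R
            (1 / (l * h (shift (case_nat a x))) * (h (case_nat a x) * \<psi> (case_nat a x)))"
        proof (cases "a \<in> sect A I (x 0)")
          case True
          then have "h (case_nat a x) > 0" by (simp add: h_pos case_nat_in_subshift x)
          then show ?thesis
            using h_pos[OF x] l_pos by (simp add: normalized_potential_def exp_diff exp_add mult_ac)
        qed simp
      qed
      then show ?thesis using transfer_shift_mult[of "\<lambda>z. 1 / (l * h z)" "\<lambda>z. h z * \<psi> z" x] by simp
    qed
    have "(\<lambda>x. transfer (\<lambda>z. h z * \<psi> z) x / (l * h x)) \<in> borel_measurable \<rho>"
      by (intro borel_measurable_divide transfer_measurable[OF h\<psi> eigenprob] borel_measurable_times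
          borel_measurable_const measurable_eigenprob[OF h_continuous])
    then have R_meas: "?R \<in> borel_measurable \<rho>"
      by (rule measurable_cong[THEN iffD2, rotated]) (simp add: R borel_prob_on_space[OF eigenprob])
    have "(\<integral>x. ?R x \<partial>gibbs) = (\<integral>x. density_fun x * ?R x \<partial>\<rho>)"
      by (rule integral_gibbs[OF R_meas])
    also have "\<dots> = (\<integral>x. (k / l) * transfer (\<lambda>z. h z * \<psi> z) x \<partial>\<rho>)"
    proof (intro Bochner_Integration.integral_cong refl)
      fix x assume "x \<in> space \<rho>"
      then have "x \<in> ?B" by (simp add: borel_prob_on_space[OF eigenprob])
      then show "density_fun x * ?R x = (k / l) * transfer (\<lambda>z. h z * \<psi> z) x"
        using h_pos[of x] by (simp add: R k)
    qed
    also have "\<dots> = (\<integral>x. k * (h x * \<psi> x) \<partial>\<rho>)"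
      using integral_transfer[OF h\<psi>] l_pos by simp
    also have "\<dots> = (\<integral>x. \<psi> x \<partial>gibbs)"
      unfolding integral_gibbs_continuous[OF \<psi>]
      by (intro Bochner_Integration.integral_cong refl) (simp add: k borel_prob_on_space[OF eigenprob])
    finally show "(\<integral>x. ?R x \<partial>gibbs) = 1 * (\<integral>x. \<psi> x \<partial>gibbs)" by simp
  qed
  then show ?thesis using assms gibbs_prob by (simp add: gibbs_state_def)
qed

abbreviation bilateral_gibbs :: "((nat \<Rightarrow> 'a) \<times> (nat \<Rightarrow> 'a)) measure" where
  "bilateral_gibbs \<equiv> bi_measure A I W normalizer \<rho>s \<rho>"

lemma bilateral_subset: "bilateral_subshift A I \<subseteq> transpose_subshift A I \<times> subshift A I"
  by (auto simp: bilateral_subshift_def)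

lemma closed_bilateral: "closed (bilateral_subshift A I)"
proof -
  have "bilateral_subshift A I
      = (transpose_subshift A I \<times> subshift A I) \<inter> (\<lambda>p. A (fst p 0) (snd p 0)) -` I"
    by (auto simp: bilateral_subshift_def)
  then show ?thesis
    by (auto intro!: closed_Int closed_Times closed_transpose closed_subshift closed_vimage I_closed A_cont_compose
        continuous_on_product_then_coordinatewise[OF continuous_on_fst[OF continuous_on_id]]
        continuous_on_product_then_coordinatewise[OF continuous_on_snd[OF continuous_on_id]])
qed

lemma sets_bilateral_gibbs: "sets bilateral_gibbs = sets (restrict_space borel (bilateral_subshift A I))"
proof -
  have "sets bilateral_gibbs = sets (restrict_space (\<rho>s \<Otimes>\<^sub>M \<rho>) (bilateral_subshift A I))"
    by (simp add: bi_measure_def sets_restrict_space)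
  also have "\<dots> = sets (restrict_space (restrict_space borel (transpose_subshift A I \<times> subshift A I)) (bilateral_subshift A I))"
    using sets_pair_borel_prob_on[OF eigenprob_star eigenprob] by (simp add: sets_restrict_space)
  also have "\<dots> = sets (restrict_space borel (bilateral_subshift A I))"
    using bilateral_subset by (simp add: sets_restrict_restrict_space Int_absorb1)
  finally show ?thesis .
qed

lemma integral_bilateral_gibbs:
  fixes G :: "(nat \<Rightarrow> 'a) \<times> (nat \<Rightarrow> 'a) \<Rightarrow> real"
  assumes G: "continuous_on (transpose_subshift A I \<times> subshift A I) G"
  shows "(\<integral>p. G p \<partial>bilateral_gibbs) = (\<integral>(y, x). kernel normalizer y x * G (y, x) \<partial>(\<rho>s \<Otimes>\<^sub>M \<rho>))"
proof -
  let ?Bh = "bilateral_subshift A I" and ?k = "\<lambda>(y, x). kernel normalizer y x"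
  note pair = borel_prob_on_pair[OF eigenprob_star eigenprob]
  have "?Bh \<in> sets (restrict_space borel (transpose_subshift A I \<times> subshift A I))"
    using bilateral_subset closed_bilateral
    by (subst sets_restrict_space_iff) (auto intro: borel_closed closed_Times closed_transpose closed_subshift)
  then have Bh: "?Bh \<in> sets (\<rho>s \<Otimes>\<^sub>M \<rho>)"
    using pair by (simp add: borel_prob_on_def)
  have cp: "compact (transpose_subshift A I \<times> subshift A I)"
    by (intro compact_Times compact_transpose compact_subshift)
  have km: "?k \<in> borel_measurable (\<rho>s \<Otimes>\<^sub>M \<rho>)" and Gm: "G \<in> borel_measurable (\<rho>s \<Otimes>\<^sub>M \<rho>)"
    by (rule borel_prob_on_integrable_continuous(1)[OF pair cp], fact kernel_continuous G)+
  have "(\<integral>p. G p \<partial>bilateral_gibbs)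
      = (\<integral>p. indicator ?Bh p *\<^sub>R G p \<partial>density (\<rho>s \<Otimes>\<^sub>M \<rho>) (\<lambda>p. ennreal (?k p)))"
    unfolding bi_measure_def
    by (subst integral_restrict_space) (use Bh sets.sets_into_space[OF Bh] in \<open>auto simp: case_prod_unfold Int_absorb2\<close>)
  also have "\<dots> = (\<integral>p. ?k p * (indicator ?Bh p *\<^sub>R G p) \<partial>(\<rho>s \<Otimes>\<^sub>M \<rho>))"
    using Bh by (intro integral_real_density km) (auto intro!: borel_measurable_times borel_measurable_indicator Gm simp: kernel_nonneg)
  also have "\<dots> = (\<integral>(y, x). kernel normalizer y x * G (y, x) \<partial>(\<rho>s \<Otimes>\<^sub>M \<rho>))"
    by (intro Bochner_Integration.integral_cong refl)
      (auto simp: borel_prob_on_space[OF pair] bi_kernel_def bilateral_subshift_def indicator_def)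
  finally show ?thesis .
qed

lemma bilateral_gibbs_right:
  fixes \<psi> :: "(nat \<Rightarrow> 'a) \<Rightarrow> real"
  assumes "continuous_on (subshift A I) \<psi>"
  shows "(\<integral>(y, x). \<psi> x \<partial>bilateral_gibbs) = (\<integral>x. \<psi> x \<partial>gibbs)"
  using integral_bilateral_gibbs[OF continuous_on_right[OF assms]]
  by (simp add: integral_kernel_marginal[OF assms] integral_gibbs_continuous[OF assms])

text \<open>Both sides share one normalization, so the mirror image of a statement speaks about the same bilateral measure.\<close>

lemma normalizer_flip: "bi_const (\<lambda>a b. A b a) I (\<lambda>(x, y). W (y, x)) \<rho> \<rho>s = normalizer"
proof -
  interpret P: pair_sigma_finite \<rho>s \<rho>
    using prob prob_star by (simp add: pair_sigma_finite_def prob_space_imp_sigma_finite)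
  have "(\<lambda>(y, x). kernel 0 y x) \<in> borel_measurable (\<rho>s \<Otimes>\<^sub>M \<rho>)"
    using kernel_mult_integrable[of "\<lambda>_. 1" 0] by (simp add: borel_measurable_integrable)
  from P.integral_product_swap[OF this] show ?thesis
    by (simp add: bi_const_def bi_kernel_def case_prod_unfold)
qed

lemma bilateral_gibbs_left:
  fixes \<psi> :: "(nat \<Rightarrow> 'a) \<Rightarrow> real"
  assumes \<psi>: "continuous_on (transpose_subshift A I) \<psi>"
    and \<mu>: "gibbs_state \<nu> (transpose_subshift A I) (sect_star A I) \<phi>s ls hs \<mu>"
  shows "(\<integral>(y, x). \<psi> y \<partial>bilateral_gibbs) = (\<integral>y. \<psi> y \<partial>\<mu>)"
proof -
  interpret F: linked_eigendata "\<lambda>a b. A b a" I \<nu> \<delta> \<alpha> \<phi>s \<phi> "\<lambda>(x, y). W (y, x)" ls l hs h \<rho>s \<rho>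
    by (rule flipped_eigendata)
  from integral_bilateral_gibbs[OF continuous_on_left[OF \<psi>]]
  have "(\<integral>(y, x). \<psi> y \<partial>bilateral_gibbs) = (\<integral>y. (\<integral>x. kernel normalizer y x \<partial>\<rho>) * \<psi> y \<partial>\<rho>s)"
    by (simp add: integral_kernel_marginal_star[OF \<psi>])
  also have "\<dots> = (\<integral>y. \<psi> y \<partial>\<mu>)"
    using F.gibbs_state_eq[of \<mu>] F.integral_gibbs_continuous[of \<psi>] \<psi> \<mu>
    unfolding flips normalizer_flip by (simp add: F.marginal_def bi_kernel_flip)
  finally show ?thesis .
qed

lemma transfer_marginal_star:
  assumes "y \<in> transpose_subshift A I"
  shows "ruelle \<nu> (sect_star A I) \<phi>s (\<lambda>y. \<integral>x. kernel c y x \<partial>\<rho>) y = ls * (\<integral>x. kernel c y x \<partial>\<rho>)"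
proof -
  interpret F: linked_eigendata "\<lambda>a b. A b a" I \<nu> \<delta> \<alpha> \<phi>s \<phi> "\<lambda>(x, y). W (y, x)" ls l hs h \<rho>s \<rho>
    by (rule flipped_eigendata)
  have "F.marginal c = (\<lambda>y. \<integral>x. kernel c y x \<partial>\<rho>)"
    by (simp add: F.marginal_def[abs_def] bi_kernel_flip)
  then show ?thesis using F.transfer_marginal'[of y c] assms by (simp only: flips)
qed

lemma integral_marginal_star: "(\<integral>y. (\<integral>x. kernel normalizer y x \<partial>\<rho>) \<partial>\<rho>s) = 1"
proof -
  interpret F: linked_eigendata "\<lambda>a b. A b a" I \<nu> \<delta> \<alpha> \<phi>s \<phi> "\<lambda>(x, y). W (y, x)" ls l hs h \<rho>s \<rho>
    by (rule flipped_eigendata)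
  show ?thesis
    using F.integral_density_fun unfolding normalizer_flip by (simp add: F.marginal_def bi_kernel_flip)
qed


section \<open>Invariance and the two bounds for the eigenvalue\<close>

lemma continuous_on_compose_shift:
  "continuous_on (subshift A I) g \<Longrightarrow> continuous_on (subshift A I) (\<lambda>x. g (shift x))"
  by (rule continuous_on_compose2[OF _ continuous_on_shift]) (auto intro: shift_in_subshift)

lemma integral_transfer_marginal:
  assumes "continuous_on (subshift A I) g"
  shows "(\<integral>x. transfer (\<lambda>z. g z * density_fun z) x \<partial>\<rho>) = l * (\<integral>x. g x \<partial>gibbs)"
  using integral_transfer[of "\<lambda>z. g z * density_fun z"] assms
  by (simp add: continuous_on_mult marginal_continuous integral_gibbs_continuous mult.commute)

text \<open>
  Composition with the shift leaves the operator as a factor, the rest of which is the eigenvalue equation of the density.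
\<close>

lemma integral_gibbs_shift:
  fixes g :: "(nat \<Rightarrow> 'a) \<Rightarrow> real"
  assumes g: "continuous_on (subshift A I) g"
  shows "(\<integral>x. g (shift x) \<partial>gibbs) = (\<integral>x. g x \<partial>gibbs)"
proof -
  have "l * (\<integral>x. g (shift x) \<partial>gibbs) = (\<integral>x. transfer (\<lambda>z. g (shift z) * density_fun z) x \<partial>\<rho>)"
    using integral_transfer_marginal[OF continuous_on_compose_shift[OF g]] by simp
  also have "\<dots> = (\<integral>x. l * (density_fun x * g x) \<partial>\<rho>)"
    by (intro Bochner_Integration.integral_cong refl)
      (simp add: transfer_shift_mult transfer_marginal' borel_prob_on_space[OF eigenprob])
  also have "\<dots> = l * (\<integral>x. g x \<partial>gibbs)"
    by (simp add: integral_gibbs_continuous[OF g])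
  finally show ?thesis using l_pos by simp
qed

lemma gibbs_invariant: "distr gibbs gibbs shift = gibbs"
proof (rule borel_prob_on_eqI)
  interpret G: prob_space gibbs using gibbs_prob by (simp add: borel_prob_on_def)
  have sets: "sets gibbs = sets (restrict_space borel (subshift A I))"
    using gibbs_prob by (simp add: borel_prob_on_def)
  have "shift \<in> measurable (restrict_space borel (subshift A I)) (restrict_space borel (subshift A I))"
    by (rule measurable_restrict_space3)
      (auto intro: borel_measurable_continuous_onI continuous_on_shift shift_in_subshift)
  then have m: "shift \<in> measurable gibbs gibbs"
    using measurable_cong_sets[OF sets sets] by blast
  show "borel_prob_on (subshift A I) (distr gibbs gibbs shift)"
    using G.prob_space_distr[OF m] sets by (simp add: borel_prob_on_def)
  fix \<psi> :: "(nat \<Rightarrow> 'a) \<Rightarrow> real" assume "continuous_on UNIV \<psi>"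
  then have \<psi>: "continuous_on (subshift A I) \<psi>" using continuous_on_subset by blast
  show "(\<integral>x. \<psi> x \<partial>distr gibbs gibbs shift) = (\<integral>x. \<psi> x \<partial>gibbs)"
    using integral_distr[OF m, of \<psi>] borel_prob_on_integrable_continuous(1)[OF gibbs_prob compact_subshift \<psi>]
      integral_gibbs_shift[OF \<psi>] by simp
qed (rule gibbs_prob)

text \<open>
  The Gibbs measure has nonpositive entropy relative to \<open>\<nu>\<close>.  With \<open>g = exp \<phi> f / (l (f \<circ> shift))\<close>, \<open>f\<close> the eigenfunction,
  \<open>g \<nu>\<close> is a probability on each section and \<open>g ln g \<ge> g - 1\<close>, while \<open>\<nu>\<close> has mass at most 1.
  Integrating \<open>ln g\<close> against the Gibbs measure leaves \<open>\<phi> - ln l\<close>, by invariance.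
\<close>

lemma ln_eigenvalue_le: "ln l \<le> (\<integral>x. \<phi> x \<partial>gibbs)"
proof -
  interpret N: prob_space \<nu> by (rule prob_\<nu>)
  interpret G: prob_space gibbs using gibbs_prob by (simp add: borel_prob_on_def)
  let ?B = "subshift A I" and ?f = density_fun
  let ?g = "\<lambda>z. exp (\<phi> z) * ?f z / (l * ?f (shift z))"
  let ?\<theta> = "\<lambda>z. \<phi> z + ln (?f z) - ln (?f (shift z)) - ln l"
  have cln: "continuous_on ?B (\<lambda>z. ln (?f z))"
    using marginal_pos by (intro continuous_on_ln marginal_continuous) (metis less_irrefl)
  have cth: "continuous_on ?B ?\<theta>"
    by (intro continuous_intros continuous_potential cln continuous_on_compose_shift[OF cln])
  note int = borel_prob_on_integrable_continuous(2)[OF gibbs_prob compact_subshift]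
  have nonneg: "transfer (\<lambda>z. ?\<theta> z * ?f z) x \<ge> 0" if x: "x \<in> ?B" for x
  proof -
    (* ?u is f (1 - 1 / g); the bound ln g \<ge> 1 - 1 / g holds pointwise, and the operator sends 1 / g to the mass of the section. *)
    let ?u = "\<lambda>z. ?f z - l * ?f (shift z) * exp (- \<phi> z)"
    have cu: "continuous_on ?B ?u"
      by (intro continuous_intros continuous_potential marginal_continuous continuous_on_compose_shift)
    have u: "transfer ?u x = l * ?f x - l * ?f x * measure \<nu> (sect A I (x 0))"
    proof -
      have i: "continuous_on ?B (\<lambda>z. l * ?f (shift z) * exp (- \<phi> z))"
        by (intro continuous_intros continuous_potential marginal_continuous continuous_on_compose_shift)
      have "transfer ?u x = transfer ?f x - transfer (\<lambda>z. l * ?f (shift z) * exp (- \<phi> z)) x"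
        unfolding ruelle_def
        by (subst set_integral_diff(2)[symmetric]; (intro transfer_integrable[OF x] marginal_continuous i)?)
          (simp add: right_diff_distrib)
      moreover have "transfer (\<lambda>z. l * ?f (shift z) * exp (- \<phi> z)) x = l * ?f x * measure \<nu> (sect A I (x 0))"
        using transfer_shift_mult[of "\<lambda>z. l * ?f z" "\<lambda>z. exp (- \<phi> z)" x] borel_prob_on_space[OF \<nu>]
        by (simp add: ruelle_def set_lebesgue_integral_def exp_minus)
      ultimately show ?thesis by (simp add: transfer_marginal' x)
    qed
    have "0 \<le> l * ?f x * (1 - measure \<nu> (sect A I (x 0)))"
      using l_pos marginal_nonneg N.prob_le_1 by (intro mult_nonneg_nonneg) auto
    then have "0 \<le> transfer ?u x" by (simp add: u right_diff_distrib)
    also have "\<dots> \<le> transfer (\<lambda>z. ?\<theta> z * ?f z) x"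
    proof (intro transfer_mono x cu continuous_on_mult cth marginal_continuous)
      fix z assume z: "z \<in> ?B"
      have f: "?f z > 0" "?f (shift z) > 0" using z marginal_pos shift_in_subshift[OF z] by auto
      have th: "exp (- ?\<theta> z) = l * ?f (shift z) * exp (- \<phi> z) / ?f z"
        using f l_pos by (simp add: exp_diff exp_add exp_minus field_simps)
      have "1 - exp (- ?\<theta> z) \<le> ?\<theta> z" using exp_ge_add_one_self[of "- ?\<theta> z"] by linarith
      then have "(1 - exp (- ?\<theta> z)) * ?f z \<le> ?\<theta> z * ?f z" using f by (intro mult_right_mono) auto
      then show "?u z \<le> ?\<theta> z * ?f z" using f unfolding th by (simp add: left_diff_distrib)
    qed
    finally show ?thesis .
  qed
  have "0 \<le> (\<integral>x. transfer (\<lambda>z. ?\<theta> z * ?f z) x \<partial>\<rho>)"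
    by (intro integral_nonneg_AE AE_I2 nonneg) (simp add: borel_prob_on_space[OF eigenprob])
  then have "0 \<le> (\<integral>x. ?\<theta> x \<partial>gibbs)"
    using integral_transfer_marginal[OF cth] l_pos by (simp add: zero_le_mult_iff)
  also have "\<dots> = (\<integral>x. \<phi> x \<partial>gibbs) - ln l"
    using int[OF continuous_potential] int[OF cln] int[OF continuous_on_compose_shift[OF cln]]
      integral_gibbs_shift[OF cln] G.prob_space by simp
  finally show ?thesis by simp
qed

text \<open>
  At points with near first entries, where the same \<open>y\<close> contribute, the logarithm of the marginal inherits the Hoelder constant
  of \<open>W\<close>, whatever \<open>\<rho>s\<close> and \<open>c\<close> are.  Replacing \<open>W\<close> by \<open>t W\<close> thus multiplies the constant by no more than \<open>t\<close>.
\<close>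

lemma marginal_variation:
  assumes x: "x \<in> subshift A I" and x': "x' \<in> subshift A I" and near: "dist (x 0) (x' 0) < \<delta>"
    and C: "\<And>p q. p \<in> bilateral_subshift A I \<Longrightarrow> q \<in> bilateral_subshift A I \<Longrightarrow>
      \<bar>W p - W q\<bar> \<le> C * pair_dist p q powr \<alpha>"
  shows "exp (- (C * seq_dist x x' powr \<alpha>)) * marginal c x \<le> marginal c x'"
proof -
  let ?e = "exp (- (C * seq_dist x x' powr \<alpha>))"
  have "?e * kernel c y x \<le> kernel c y x'" if y: "y \<in> transpose_subshift A I" for y
  proof (cases "A (y 0) (x 0) \<in> I")
    case True
    then have same: "A (y 0) (x' 0) \<in> I"
      using sect_const[OF x near] by (auto simp: sect_def)
    then have "\<bar>W (y, x) - W (y, x')\<bar> \<le> C * seq_dist x x' powr \<alpha>"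
      using C[of "(y, x)" "(y, x')"] x x' y True by (simp add: bilateral_subshift_def pair_dist_def)
    then have "exp (- (C * seq_dist x x' powr \<alpha>) + (W (y, x) - c)) \<le> exp (W (y, x') - c)" by simp
    then show ?thesis using True same by (simp add: bi_kernel_def mult_exp_exp)
  qed (simp add: bi_kernel_def)
  then have "(\<integral>y. ?e * kernel c y x \<partial>\<rho>s) \<le> marginal c x'"
    unfolding marginal_def using x x' kernel_integrable
    by (intro integral_mono) (auto simp: borel_prob_on_space[OF eigenprob_star])
  then show ?thesis by (simp add: marginal_def)
qed

text \<open>
  Changing only the first entry of \<open>z\<close> by less than \<open>r\<close> keeps \<open>z\<close> in the subshift.  Restricting the integral
  in the eigenvalue equation at \<open>shift z\<close> to that ball gives
  \<open>\<phi> z + ln (f z) - ln (f (shift z)) \<le> ln l - ln \<eta> + error\<close>, whose left side integrates to \<open>\<integral> \<phi> d\<mu>\<close>.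
\<close>

lemma integral_le_ln_eigenvalue:
  assumes \<mu>: "borel_prob_on (subshift A I) \<mu>" and inv: "distr \<mu> \<mu> shift = \<mu>"
    and r: "0 < r" "r \<le> \<delta>" and \<eta>: "0 < \<eta>" "\<And>a. \<eta> \<le> measure \<nu> (ball a r)"
    and C: "C \<ge> 0" "\<And>p q. p \<in> bilateral_subshift A I \<Longrightarrow> q \<in> bilateral_subshift A I \<Longrightarrow>
      \<bar>W p - W q\<bar> \<le> C * pair_dist p q powr \<alpha>"
    and D: "D \<ge> 0" "\<And>x z. x \<in> subshift A I \<Longrightarrow> z \<in> subshift A I \<Longrightarrow> \<bar>\<phi> x - \<phi> z\<bar> \<le> D * seq_dist x z powr \<alpha>"
  shows "(\<integral>x. \<phi> x \<partial>\<mu>) \<le> ln l - ln \<eta> + (C + D) * r powr \<alpha>"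
proof -
  interpret N: prob_space \<nu> by (rule prob_\<nu>)
  interpret P: prob_space \<mu> using \<mu> by (simp add: borel_prob_on_def)
  let ?B = "subshift A I" and ?f = density_fun
  let ?\<kappa> = "(C + D) * r powr \<alpha>"
  have cln: "continuous_on ?B (\<lambda>z. ln (?f z))"
    using marginal_pos by (intro continuous_on_ln marginal_continuous) (metis less_irrefl)
  note cln' = continuous_on_compose_shift[OF cln]
  note int = borel_prob_on_integrable_continuous(2)[OF \<mu> compact_subshift]
  have key: "\<phi> z + ln (?f z) - ln (?f (shift z)) \<le> ln l - ln \<eta> + ?\<kappa>" if z: "z \<in> ?B" for z
  proof -
    let ?x = "shift z" and ?U = "ball (z 0) r"
    have x: "?x \<in> ?B" by (rule shift_in_subshift[OF z])
    have f: "?f z > 0" "?f ?x > 0" using z x marginal_pos by auto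
    obtain y where y: "y \<in> transpose_subshift A I" "y 0 = z 0" using extend_left[OF z] by blast
    have U: "?U \<subseteq> sect A I (?x 0)"
    proof
      fix a assume "a \<in> ?U"
      then have "sect_star A I a = sect_star A I (z 0)" using sect_star_const[OF y(1), of a] y(2) r by simp
      then show "a \<in> sect A I (?x 0)" using head_in_sect[OF z] by (auto simp: sect_def sect_star_def)
    qed
    have low: "exp (- ?\<kappa>) * (exp (\<phi> z) * ?f z) \<le> exp (\<phi> (case_nat a ?x)) * ?f (case_nat a ?x)" if a: "a \<in> ?U" for a
    proof -
      have a': "case_nat a ?x \<in> ?B" using a U x by (auto simp: case_nat_in_subshift)
      have "seq_dist z (case_nat a ?x) = dist (z 0) a / 2"
        using seq_dist_case_nat[OF M_compact, of "z 0" ?x a ?x] by simp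
      then have "seq_dist z (case_nat a ?x) \<le> r" using a r(1) by simp
      then have sd: "seq_dist z (case_nat a ?x) powr \<alpha> \<le> r powr \<alpha>"
        using \<alpha> by (intro powr_mono2) (auto simp: seq_dist_nonneg[OF M_compact])
      have "\<phi> z - \<phi> (case_nat a ?x) \<le> D * r powr \<alpha>"
        using D(2)[OF z a'] mult_left_mono[OF sd D(1)] by linarith
      then have 1: "exp (- (D * r powr \<alpha>)) * exp (\<phi> z) \<le> exp (\<phi> (case_nat a ?x))"
        by (simp add: exp_add[symmetric])
      have "exp (- (C * r powr \<alpha>)) * ?f z \<le> exp (- (C * seq_dist z (case_nat a ?x) powr \<alpha>)) * ?f z"
        using mult_left_mono[OF sd C(1)] f by (intro mult_right_mono) auto
      also have "\<dots> \<le> ?f (case_nat a ?x)"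
        using marginal_variation[OF z a' _ C(2)] a r by simp
      finally have 2: "exp (- (C * r powr \<alpha>)) * ?f z \<le> ?f (case_nat a ?x)" .
      have "exp (- ?\<kappa>) * (exp (\<phi> z) * ?f z)
          = (exp (- (D * r powr \<alpha>)) * exp (\<phi> z)) * (exp (- (C * r powr \<alpha>)) * ?f z)"
        by (simp add: distrib_right exp_diff exp_minus field_simps)
      also have "\<dots> \<le> exp (\<phi> (case_nat a ?x)) * ?f (case_nat a ?x)"
        using f by (intro mult_mono 1 2) auto
      finally show ?thesis .
    qed
    have "\<eta> * (exp (- ?\<kappa>) * (exp (\<phi> z) * ?f z)) \<le> measure \<nu> ?U * (exp (- ?\<kappa>) * (exp (\<phi> z) * ?f z))"
      using \<eta> f by (intro mult_right_mono) auto
    also have "\<dots> = (\<integral>a. indicator ?U a * (exp (- ?\<kappa>) * (exp (\<phi> z) * ?f z)) \<partial>\<nu>)"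
      by (simp add: borel_prob_on_space[OF \<nu>])
    also have "\<dots> \<le> transfer ?f ?x"
      unfolding ruelle_def set_lebesgue_integral_def
    proof (rule integral_mono)
      have "?U \<in> sets \<nu>" using \<nu> by (simp add: borel_prob_on_def sets_restrict_space_iff)
      then show "integrable \<nu> (\<lambda>a. indicator ?U a * (exp (- ?\<kappa>) * (exp (\<phi> z) * ?f z)))"
        by (intro integrable_mult_left) (simp add: N.emeasure_finite less_top[symmetric])
      show "integrable \<nu> (\<lambda>a. indicator (sect A I (?x 0)) a *\<^sub>R exp (\<phi> (case_nat a ?x)) *\<^sub>R ?f (case_nat a ?x))"
        using transfer_integrable[OF x marginal_continuous] by (simp add: set_integrable_def)
      fix a
      have "a \<in> sect A I (?x 0) \<Longrightarrow> 0 \<le> exp (\<phi> (case_nat a ?x)) * ?f (case_nat a ?x)"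
        by (intro mult_nonneg_nonneg marginal_nonneg) simp
      then show "indicator ?U a * (exp (- ?\<kappa>) * (exp (\<phi> z) * ?f z))
        \<le> indicator (sect A I (?x 0)) a *\<^sub>R exp (\<phi> (case_nat a ?x)) *\<^sub>R ?f (case_nat a ?x)"
        using low[of a] U by (cases "a \<in> ?U") (auto simp: indicator_def)
    qed
    also have "\<dots> = l * ?f ?x" by (rule transfer_marginal'[OF x])
    finally have "ln (\<eta> * (exp (- ?\<kappa>) * (exp (\<phi> z) * ?f z))) \<le> ln (l * ?f ?x)"
      using \<eta> f l_pos by (subst ln_le_cancel_iff) (auto intro!: mult_pos_pos)
    then show ?thesis using \<eta> f l_pos by (simp add: ln_mult ln_div)
  qed
  have "(\<integral>x. ln (?f (shift x)) \<partial>\<mu>) = (\<integral>x. ln (?f x) \<partial>distr \<mu> \<mu> shift)"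
  proof (rule integral_distr[symmetric])
    have sets: "sets \<mu> = sets (restrict_space borel ?B)" using \<mu> by (simp add: borel_prob_on_def)
    have "shift \<in> measurable (restrict_space borel ?B) (restrict_space borel ?B)"
      by (rule measurable_restrict_space3)
        (auto intro: borel_measurable_continuous_onI continuous_on_shift shift_in_subshift)
    then show "shift \<in> measurable \<mu> \<mu>" using measurable_cong_sets[OF sets sets] by blast
  qed (rule borel_prob_on_integrable_continuous(1)[OF \<mu> compact_subshift cln])
  then have shift_eq: "(\<integral>x. ln (?f (shift x)) \<partial>\<mu>) = (\<integral>x. ln (?f x) \<partial>\<mu>)" by (simp add: inv)
  have "(\<integral>x. \<phi> x \<partial>\<mu>) = (\<integral>x. \<phi> x + ln (?f x) - ln (?f (shift x)) \<partial>\<mu>)"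
    using int[OF continuous_potential] int[OF cln] int[OF cln'] shift_eq by simp
  also have "\<dots> \<le> (\<integral>x. ln l - ln \<eta> + ?\<kappa> \<partial>\<mu>)"
    using key by (intro integral_mono int continuous_intros continuous_potential cln cln')
      (auto simp: borel_prob_on_space[OF \<mu>])
  also have "\<dots> = ln l - ln \<eta> + ?\<kappa>" using P.prob_space by simp
  finally show ?thesis .
qed

end


section \<open>Local constancy of the transposed sections\<close>

lemma uniformly_locally_constant:
  fixes s :: "'a::metric_space \<Rightarrow> 'b"
  assumes "compact K" "\<And>b. b \<in> K \<Longrightarrow> \<exists>U. open U \<and> b \<in> U \<and> (\<forall>c\<in>U. s c = s b)"
  shows "\<exists>\<delta>>0. \<forall>b\<in>K. \<forall>c. dist b c < \<delta> \<longrightarrow> s c = s b"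
proof -
  let ?G = "{U. open U \<and> (\<exists>b\<in>U. \<forall>c\<in>U. s c = s b)}"
  have sub: "K \<subseteq> \<Union>?G" using assms(2) by blast
  have opn: "\<And>G. G \<in> ?G \<Longrightarrow> open G" by blast
  obtain e where e: "e > 0" "\<And>x. x \<in> K \<Longrightarrow> \<exists>U\<in>?G. ball x e \<subseteq> U"
    by (rule Heine_Borel_lemma[OF assms(1) sub opn]) (assumption, rule that)
  have "s c = s b" if "b \<in> K" "dist b c < e" for b c
  proof -
    obtain U where U: "U \<in> ?G" "ball b e \<subseteq> U" using e(2)[OF \<open>b \<in> K\<close>] by blast
    obtain b' where b': "\<forall>c\<in>U. s c = s b'" using U(1) by blast
    have "b \<in> U" "c \<in> U" using U(2) e(1) that(2) by (auto simp: subset_iff)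
    then show ?thesis using b' by simp
  qed
  then show ?thesis using e(1) by blast
qed

lemma finite_ball_cover:
  fixes e :: real
  assumes "compact (UNIV :: 'a::metric_space set)" "e > 0"
  shows "\<exists>J. finite J \<and> (UNIV :: 'a set) \<subseteq> (\<Union>b\<in>J. ball b e)"
  using assms unfolding compact_eq_totally_bounded by blast

context compact_alphabet
begin

text \<open>An empty section would make the operator vanish at \<open>x\<close>, against positivity of \<open>l h x\<close>.\<close>

lemma eigenfunction_section_nonempty:
  fixes h :: "(nat \<Rightarrow> 'a) \<Rightarrow> real"
  assumes "ruelle \<nu> (sect A I) \<phi> h x = l * h x" "l > 0" "h x > 0"
  shows "sect A I (x 0) \<noteq> {}"
proof
  assume "sect A I (x 0) = {}"
  then have "l * h x = 0" using assms(1) by (simp add: ruelle_def set_lebesgue_integral_def)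
  then show False using assms(2,3) by simp
qed

lemma weight_hoelder:
  fixes \<phi> h :: "(nat \<Rightarrow> 'a) \<Rightarrow> real"
  assumes \<alpha>: "\<alpha> > 0" and \<phi>: "hoelder_on seq_dist \<alpha> (subshift A I) \<phi>" and h: "hoelder_on seq_dist \<alpha> (subshift A I) h"
  shows "hoelder_on seq_dist \<alpha> (subshift A I) (\<lambda>x. exp (\<phi> x) * h x)"
proof -
  let ?B = "subshift A I"
  have bdd: "\<exists>Q\<ge>0. \<forall>x\<in>?B. \<bar>g x\<bar> \<le> Q" if g: "hoelder_on seq_dist \<alpha> ?B g" for g :: "(nat \<Rightarrow> 'a) \<Rightarrow> real"
  proof -
    obtain Q where "\<forall>x\<in>?B. norm (g x) \<le> Q"
      using compact_imp_bounded[OF compact_continuous_image[OF hoelder_on_imp_continuous_on[OF M_compact \<alpha> g] compact_subshift]]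
      unfolding bounded_iff by blast
    then show ?thesis by (intro exI[of _ "max Q 0"]) auto
  qed
  obtain P where P: "\<forall>x\<in>?B. \<bar>\<phi> x\<bar> \<le> P" using bdd[OF \<phi>] by blast
  obtain Q where Q: "Q \<ge> 0" "\<forall>x\<in>?B. \<bar>h x\<bar> \<le> Q" using bdd[OF h] by blast
  obtain C where C: "C \<ge> 0" "\<forall>x\<in>?B. \<forall>z\<in>?B. norm (\<phi> x - \<phi> z) \<le> C * seq_dist x z powr \<alpha>"
    using \<phi> unfolding hoelder_on_def by blast
  obtain D where D: "D \<ge> 0" "\<forall>x\<in>?B. \<forall>z\<in>?B. norm (h x - h z) \<le> D * seq_dist x z powr \<alpha>"
    using h unfolding hoelder_on_def by blast
  show ?thesis
    unfolding hoelder_on_def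
  proof (intro exI[of _ "exp P * C * Q + exp P * D"] conjI ballI)
    show "exp P * C * Q + exp P * D \<ge> 0" using C D Q by simp
    fix x z assume x: "x \<in> ?B" and z: "z \<in> ?B"
    let ?d = "seq_dist x z powr \<alpha>"
    have "\<bar>exp (\<phi> x) - exp (\<phi> z)\<bar> \<le> exp P * \<bar>\<phi> x - \<phi> z\<bar>"
      using P x z by (intro exp_diff_le) (auto simp: abs_le_iff)
    also have "\<dots> \<le> exp P * (C * ?d)" using C x z by (intro mult_left_mono) auto
    finally have "\<bar>exp (\<phi> x) - exp (\<phi> z)\<bar> * \<bar>h x\<bar> \<le> exp P * (C * ?d) * Q"
      using Q x C by (intro mult_mono) auto
    moreover have "exp (\<phi> z) * \<bar>h x - h z\<bar> \<le> exp P * (D * ?d)"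
      using D x z P by (intro mult_mono) (auto simp: abs_le_iff)
    moreover have "exp (\<phi> x) * h x - exp (\<phi> z) * h z = (exp (\<phi> x) - exp (\<phi> z)) * h x + exp (\<phi> z) * (h x - h z)"
      by (simp add: algebra_simps)
    ultimately have "\<bar>exp (\<phi> x) * h x - exp (\<phi> z) * h z\<bar> \<le> exp P * (C * ?d) * Q + exp P * (D * ?d)"
      using abs_triangle_ineq[of "(exp (\<phi> x) - exp (\<phi> z)) * h x" "exp (\<phi> z) * (h x - h z)"] by (simp add: abs_mult)
    then show "norm (exp (\<phi> x) * h x - exp (\<phi> z) * h z) \<le> (exp P * C * Q + exp P * D) * ?d"
      by (simp add: algebra_simps)
  qed
qed

text \<open>
  The section at \<open>a\<close> is determined by which of the finitely many values of \<open>sect_star\<close> contain \<open>a\<close>.  Values without \<open>x 0\<close> are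
  closed, so they contain no entry near \<open>x 0\<close>.  Let \<open>K\<close> be a value and \<open>x 0 \<in> K\<close>.  If entries \<open>a\<close> outside \<open>K\<close> approached \<open>x 0\<close>,
  then replacing \<open>x 0\<close> by \<open>a\<close> would remove from the section the open set of symbols \<open>b\<close> with \<open>sect_star b = K\<close>,
  and full support of \<open>\<nu>\<close> would make the continuous function \<open>l h\<close>, an integral over the section, jump.
\<close>

lemma sect_locally_constant:
  fixes \<phi> h :: "(nat \<Rightarrow> 'a) \<Rightarrow> real"
  assumes lc: "locally_constant (sect_star A I)" and full: "full_support \<nu>" and \<alpha>: "\<alpha> > 0"
    and \<phi>: "hoelder_on seq_dist \<alpha> (subshift A I) \<phi>" and h: "hoelder_on seq_dist \<alpha> (subshift A I) h"
    and h_pos: "\<And>x. x \<in> subshift A I \<Longrightarrow> h x > 0"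
    and l: "l > 0" and eig: "\<And>x. x \<in> subshift A I \<Longrightarrow> ruelle \<nu> (sect A I) \<phi> h x = l * h x"
    and x: "x \<in> subshift A I"
  shows "\<exists>U. open U \<and> x 0 \<in> U \<and> (\<forall>a\<in>U. sect A I a = sect A I (x 0))"
proof -
  interpret N: prob_space \<nu> by (rule prob_\<nu>)
  interpret F: compact_alphabet "\<lambda>a b. A b a" I \<nu> by (rule flipped_alphabet)
  let ?B = "subshift A I" and ?s = "sect_star A I" and ?S = "range (sect_star A I)"
  have closed_star: "closed (?s b)" for b using F.closed_sect[of b] by (simp only: flips)
  have cont: "continuous_on ?B \<phi>" "continuous_on ?B h"
    using hoelder_on_imp_continuous_on[OF M_compact \<alpha>] \<phi> h by auto
  have "\<exists>U. open U \<and> b \<in> U \<and> (\<forall>c\<in>U. ?s c = ?s b)" for b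
    using lc unfolding locally_constant_def by (rule spec)
  then have "\<exists>e>0. \<forall>b\<in>UNIV. \<forall>c. dist b c < e \<longrightarrow> ?s c = ?s b"
    by (rule uniformly_locally_constant[OF M_compact])
  then obtain e0 where e0: "e0 > 0" "\<And>b c. dist b c < e0 \<Longrightarrow> ?s c = ?s b" by auto
  have fin: "finite ?S"
  proof -
    obtain J :: "'a set" where "finite J" "UNIV \<subseteq> (\<Union>b\<in>J. ball b e0)"
      using finite_ball_cover[OF M_compact e0(1)] by blast
    have "?S \<subseteq> ?s ` J"
    proof
      fix K assume "K \<in> ?S"
      then obtain c where c: "K = ?s c" by blast
      have "c \<in> (\<Union>b\<in>J. ball b e0)" using \<open>UNIV \<subseteq> (\<Union>b\<in>J. ball b e0)\<close> by blast
      then obtain b where "b \<in> J" "dist b c < e0" by auto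
      then show "K \<in> ?s ` J" using e0(2) c by blast
    qed
    then show ?thesis using \<open>finite J\<close> by (rule finite_surj[rotated])
  qed
  let ?U1 = "\<Inter>K\<in>{K\<in>?S. x 0 \<notin> K}. - K"
  have U1: "open ?U1" "x 0 \<in> ?U1"
    using fin closed_star by (auto intro!: open_INT)
  obtain L where L: "L \<ge> 0" "\<And>z z'. z \<in> ?B \<Longrightarrow> z' \<in> ?B \<Longrightarrow>
      \<bar>exp (\<phi> z) * h z - exp (\<phi> z') * h z'\<bar> \<le> L * seq_dist z z' powr \<alpha>"
    using weight_hoelder[OF \<alpha> \<phi> h] unfolding hoelder_on_def by auto
  obtain C where C: "C \<ge> 0" "\<And>z z'. z \<in> ?B \<Longrightarrow> z' \<in> ?B \<Longrightarrow> \<bar>h z - h z'\<bar> \<le> C * seq_dist z z' powr \<alpha>"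
    using h unfolding hoelder_on_def by auto
  obtain w where w: "w \<in> ?B" "\<And>z. z \<in> ?B \<Longrightarrow> exp (\<phi> w) * h w \<le> exp (\<phi> z) * h z"
    using continuous_attains_inf[OF compact_subshift, of "\<lambda>z. exp (\<phi> z) * h z"] x
      continuous_on_mult[OF continuous_on_exp[OF cont(1)] cont(2)] by blast
  define q0 where "q0 = exp (\<phi> w) * h w"
  have q0: "q0 > 0" "\<And>z. z \<in> ?B \<Longrightarrow> q0 \<le> exp (\<phi> z) * h z" using w h_pos by (auto simp: q0_def)
  have interior: "x 0 \<in> interior K" if K: "K \<in> ?S" "x 0 \<in> K" for K
  proof (rule ccontr)
    assume notin: "x 0 \<notin> interior K"
    obtain b0 where b0: "K = ?s b0" using K by blast
    let ?D = "{b. ?s b = K}"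
    have oD: "open ?D"
    proof (subst open_subopen, intro ballI)
      fix b assume b: "b \<in> ?D"
      obtain U where U: "open U" "b \<in> U" "\<forall>c\<in>U. ?s c = ?s b"
        using lc unfolding locally_constant_def by meson
      have "U \<subseteq> ?D"
      proof
        fix c assume "c \<in> U"
        then have "?s c = ?s b" by (rule U(3)[rule_format])
        also have "\<dots> = K" using b by simp
        finally show "c \<in> ?D" by simp
      qed
      then show "\<exists>T. open T \<and> b \<in> T \<and> T \<subseteq> ?D" using U(1,2) by blast
    qed
    then have mD: "measure \<nu> ?D > 0" "?D \<in> sets \<nu>"
      using full b0 sets_\<nu>[OF oD] by (auto simp: full_support_def N.emeasure_eq_measure)
    (* Symbols in ?D are lost at a, each at a cost of at least q0; every other change is controlled by Hoelder continuity. *)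
    have jump: "q0 * measure \<nu> ?D \<le> (L + l * C) * dist a (x 0) powr \<alpha>"
      if a: "a \<in> ?U1" "dist (x 0) a < e0" "a \<notin> K" for a
    proof -
      let ?x = "case_nat a (shift x)" and ?d = "dist a (x 0) powr \<alpha>"
      have "?s a = ?s (x 0)" by (rule e0(2)[OF a(2)])
      then have x': "?x \<in> ?B"
        using head_in_sect[OF x] shift_in_subshift[OF x] by (auto simp: case_nat_in_subshift sect_def sect_star_def)
      have dx: "seq_dist ?x x = dist a (x 0) / 2"
        using seq_dist_case_nat[OF M_compact, of a "shift x" "x 0" "shift x"] by simp
      have near: "seq_dist z z' powr \<alpha> \<le> ?d" if "seq_dist z z' \<le> dist a (x 0)" for z z' :: "nat \<Rightarrow> 'a"
        using that \<alpha> by (intro powr_mono2) (auto simp: seq_dist_nonneg[OF M_compact])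
      have sub: "b \<in> sect A I (x 0) \<and> b \<notin> ?D" if "b \<in> sect A I a" for b
      proof -
        have "a \<in> ?s b" using that by (simp add: sect_def sect_star_def)
        then have "x 0 \<in> ?s b" using a(1) by blast
        then show ?thesis using \<open>a \<in> ?s b\<close> a(3) by (auto simp: sect_def sect_star_def)
      qed
      have D_sub: "?D \<subseteq> sect A I (x 0)" using K(2) by (auto simp: sect_def sect_star_def)
      let ?F = "\<lambda>x b. indicator (sect A I (x 0)) b * (exp (\<phi> (case_nat b x)) * h (case_nat b x))"
      have int: "integrable \<nu> (?F z)" if "z \<in> ?B" for z
        using ruelle_integrable[OF that cont] by (simp add: set_integrable_def)
      have R: "l * h z = (\<integral>b. ?F z b \<partial>\<nu>)" if "z \<in> ?B" for z
        using eig[OF that] by (simp add: ruelle_def set_lebesgue_integral_def)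
      have intD: "integrable \<nu> (\<lambda>b. indicator ?D b * q0)"
        using mD by (intro integrable_mult_left) (simp add: N.emeasure_finite less_top[symmetric])
      have "?F ?x b \<le> ?F x b - indicator ?D b * q0 + L * ?d" for b
      proof (cases "b \<in> sect A I a")
        case True
        then have b: "b \<in> sect A I (x 0)" "b \<notin> ?D" using sub by auto
        have "seq_dist (case_nat b ?x) (case_nat b x) = dist a (x 0) / 4"
          using seq_dist_case_nat[OF M_compact, of b ?x b x] dx by simp
        then have "L * seq_dist (case_nat b ?x) (case_nat b x) powr \<alpha> \<le> L * ?d"
          by (intro mult_left_mono near L(1)) (use zero_le_dist[of a "x 0"] in linarith)
        then have "\<bar>exp (\<phi> (case_nat b ?x)) * h (case_nat b ?x) - exp (\<phi> (case_nat b x)) * h (case_nat b x)\<bar> \<le> L * ?d"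
          using L(2)[of "case_nat b ?x" "case_nat b x"] True b x x' by (auto simp: case_nat_in_subshift)
        then show ?thesis using True b by simp
      next
        case False
        have "L * ?d \<ge> 0" using L(1) by simp
        moreover have "0 \<le> ?F x b - indicator ?D b * q0"
        proof (cases "b \<in> sect A I (x 0)")
          case True
          then have "case_nat b x \<in> ?B" using x by (simp add: case_nat_in_subshift)
          from q0(2)[OF this] q0(1) show ?thesis using True by (auto simp: indicator_def)
        qed (use D_sub in \<open>auto simp: indicator_def\<close>)
        ultimately show ?thesis using False by simp
      qed
      then have "(\<integral>b. ?F ?x b \<partial>\<nu>) \<le> (\<integral>b. ?F x b - indicator ?D b * q0 + L * ?d \<partial>\<nu>)"
        by (intro integral_mono int x x' Bochner_Integration.integrable_add Bochner_Integration.integrable_diff intD) auto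
      also have "\<dots> = (\<integral>b. ?F x b \<partial>\<nu>) - (\<integral>b. indicator ?D b * q0 \<partial>\<nu>) + L * ?d"
        using int[OF x] intD N.prob_space by simp
      also have "(\<integral>b. indicator ?D b * q0 \<partial>\<nu>) = q0 * measure \<nu> ?D"
        by (simp add: borel_prob_on_space[OF \<nu>])
      finally have "l * h ?x \<le> l * h x - q0 * measure \<nu> ?D + L * ?d" using R[OF x] R[OF x'] by simp
      moreover have "h x - h ?x \<le> C * ?d"
      proof -
        have "C * seq_dist ?x x powr \<alpha> \<le> C * ?d" by (intro mult_left_mono near C(1)) (use dx zero_le_dist[of a "x 0"] in linarith)
        then show ?thesis using C(2)[OF x' x] by linarith
      qed
      then have "l * (h x - h ?x) \<le> l * (C * ?d)" using l by (intro mult_left_mono) auto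
      ultimately show ?thesis by (simp add: algebra_simps)
    qed
    have "((\<lambda>a. dist a (x 0)) \<longlongrightarrow> dist (x 0) (x 0)) (nhds (x 0))"
      by (intro tendsto_dist filterlim_ident tendsto_const)
    then have lim: "((\<lambda>a. dist a (x 0)) \<longlongrightarrow> 0) (nhds (x 0))" by simp
    have "((\<lambda>a. (L + l * C) * dist a (x 0) powr \<alpha>) \<longlongrightarrow> (L + l * C) * 0) (nhds (x 0))"
      using \<alpha> by (intro tendsto_mult_left tendsto_powr_zero lim) auto
    then have "\<forall>\<^sub>F a in nhds (x 0). (L + l * C) * dist a (x 0) powr \<alpha> < q0 * measure \<nu> ?D"
      using q0 mD by (intro order_tendstoD) auto
    moreover have "\<forall>\<^sub>F a in nhds (x 0). a \<in> ?U1" using U1 by (rule eventually_nhds_in_open)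
    moreover have "\<forall>\<^sub>F a in nhds (x 0). a \<in> ball (x 0) e0"
      using e0(1) by (intro eventually_nhds_in_open) auto
    ultimately have "\<forall>\<^sub>F a in nhds (x 0). a \<in> K"
    proof eventually_elim
      case (elim a)
      have "dist (x 0) a < e0" using elim(3) by simp
      then show ?case using jump[OF elim(2)] elim(1) by linarith
    qed
    then have "x 0 \<in> interior K" unfolding eventually_nhds by (auto simp: interior_def)
    then show False using notin by contradiction
  qed
  let ?U = "?U1 \<inter> (\<Inter>K\<in>{K\<in>?S. x 0 \<in> K}. interior K)"
  have oU: "open ?U"
  proof (rule open_Int[OF U1(1)])
    show "open (\<Inter>K\<in>{K\<in>?S. x 0 \<in> K}. interior K)"
      using fin by (intro open_INT) auto
  qed
  have xU: "x 0 \<in> ?U" using U1(2) interior by blast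
  have sU: "sect A I a = sect A I (x 0)" if a: "a \<in> ?U" for a
  proof -
    have "a \<in> K \<longleftrightarrow> x 0 \<in> K" if "K \<in> ?S" for K
      using a that interior_subset by blast
    then have "a \<in> ?s b \<longleftrightarrow> x 0 \<in> ?s b" for b by blast
    then show ?thesis by (auto simp: sect_def sect_star_def)
  qed
  show ?thesis
  proof (intro exI[of _ ?U] conjI ballI)
    show "open ?U" by (rule oU)
    show "x 0 \<in> ?U" by (rule xU)
    show "sect A I a = sect A I (x 0)" if "a \<in> ?U" for a by (rule sU[OF that])
  qed
qed

end


section \<open>Duality and maximizing accumulation points\<close>

lemma hoelder_on_cmult:
  fixes \<psi> :: "'x \<Rightarrow> real"
  assumes "hoelder_on d \<alpha> Y \<psi>"
  shows "hoelder_on d \<alpha> Y (\<lambda>x. t * \<psi> x)"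
proof -
  obtain C where C: "C \<ge> 0" "\<forall>x\<in>Y. \<forall>y\<in>Y. norm (\<psi> x - \<psi> y) \<le> C * d x y powr \<alpha>"
    using assms unfolding hoelder_on_def by blast
  have "norm (t * \<psi> x - t * \<psi> y) \<le> \<bar>t\<bar> * C * d x y powr \<alpha>" if "x \<in> Y" "y \<in> Y" for x y
    using mult_left_mono[of "norm (\<psi> x - \<psi> y)" "C * d x y powr \<alpha>" "\<bar>t\<bar>"] C that
    by (simp add: right_diff_distrib[symmetric] abs_mult mult.assoc)
  then show ?thesis unfolding hoelder_on_def using C(1) by (intro exI[of _ "\<bar>t\<bar> * C"]) auto
qed

lemma full_support_ball_lower_bound:
  fixes \<nu> :: "'a::metric_space measure"
  assumes "compact (UNIV :: 'a set)" "borel_prob_on UNIV \<nu>" "full_support \<nu>" "r > 0"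
  shows "\<exists>\<eta>>0. \<forall>a. \<eta> \<le> measure \<nu> (ball a r)"
proof -
  interpret prob_space \<nu> using assms(2) by (simp add: borel_prob_on_def)
  obtain J where J: "finite J" "UNIV \<subseteq> (\<Union>b\<in>J. ball b (r / 2) :: 'a set)"
    using finite_ball_cover[OF assms(1) half_gt_zero[OF assms(4)]] by blast
  let ?E = "(\<lambda>b. measure \<nu> (ball b (r / 2))) ` J"
  have ne: "finite ?E" "?E \<noteq> {}" using J by auto
  have "measure \<nu> (ball b (r / 2)) > 0" for b
    using assms(3,4) unfolding full_support_def emeasure_eq_measure by simp
  then have pos: "Min ?E > 0" using ne by (subst Min_gr_iff) auto
  have "Min ?E \<le> measure \<nu> (ball a r)" for a
  proof -
    obtain b where b: "b \<in> J" "a \<in> ball b (r / 2)" using J by blast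
    have "ball b (r / 2) \<subseteq> ball a r"
    proof
      fix z assume "z \<in> ball b (r / 2)"
      then show "z \<in> ball a r" using b(2) dist_triangle_half_r[of b a r z] by simp
    qed
    moreover have "ball a r \<in> sets \<nu>"
      using assms(2) by (simp add: borel_prob_on_def sets_restrict_space_iff)
    ultimately have "measure \<nu> (ball b (r / 2)) \<le> measure \<nu> (ball a r)" by (intro finite_measure_mono)
    moreover have "Min ?E \<le> measure \<nu> (ball b (r / 2))" using b ne by (intro Min_le) auto
    ultimately show ?thesis by linarith
  qed
  then show ?thesis using pos by blast
qed

lemma (in linked_potentials) scaled:
  "linked_potentials A I \<nu> \<delta> \<alpha> (\<lambda>x. t * \<phi> x) (\<lambda>y. t * \<phi>s y) (\<lambda>p. t * W p)"
proof (unfold_locales)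
  show "t * \<phi>s y = t * \<phi> (tau y x) + t * W (shift y, tau y x) - t * W (y, x)"
    if "(y, x) \<in> bilateral_subshift A I" for y x
    by (simp add: link[OF that] algebra_simps)
qed (intro \<alpha> hoelder_on_cmult \<phi> W \<phi>s)+

text \<open>
  By the entropy bound the mean of \<open>\<phi>\<close> over the Gibbs measure at parameter \<open>t\<close> is at least \<open>ln (L t) / t\<close>, and by the
  opposite bound \<open>ln (L t) / t\<close> falls short of the mean over an invariant measure by at most
  \<open>(C + D) r powr \<alpha> - ln \<eta> / t\<close>.
  Here \<open>\<eta>\<close>, a lower bound for the mass of balls of radius \<open>r\<close>, is independent of \<open>t\<close>: choose \<open>r\<close> first, then \<open>t\<close>.
\<close>

lemma (in linked_potentials) gibbs_maximizing_limit:
  assumes full: "full_support \<nu>"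
    and data: "\<And>t. t > 1 \<Longrightarrow> linked_eigendata A I \<nu> \<delta> \<alpha> (\<lambda>x. t * \<phi> x) (\<lambda>y. t * \<phi>s y) (\<lambda>p. t * W p)
      (L t) (Ls t) (H t) (Hs t) (R t) (Rs t)"
  defines "J \<equiv> \<lambda>t. \<integral>(y, x). \<phi> x \<partial>bi_measure A I (\<lambda>p. t * W p) (bi_const A I (\<lambda>p. t * W p) (Rs t) (R t)) (Rs t) (R t)"
  shows "(J \<longlongrightarrow> max_integral (subshift A I) \<phi>) at_top"
proof -
  let ?B = "subshift A I" and ?Bh = "bilateral_subshift A I"
  let ?M = "{\<mu>. borel_prob_on ?B \<mu> \<and> distr \<mu> \<mu> shift = \<mu>}"
  let ?m = "max_integral ?B \<phi>"
  obtain Q where Q: "\<And>x. x \<in> ?B \<Longrightarrow> \<bar>\<phi> x\<bar> \<le> Q"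
    using compact_imp_bounded[OF compact_continuous_image[OF continuous_potential compact_subshift]]
    unfolding bounded_iff by auto
  have bdd: "bdd_above ((\<lambda>\<mu>. \<integral>x. \<phi> x \<partial>\<mu>) ` ?M)"
  proof (rule bdd_aboveI2)
    fix \<mu> assume "\<mu> \<in> ?M"
    then have \<mu>: "borel_prob_on ?B \<mu>" by simp
    interpret prob_space \<mu> using \<mu> by (simp add: borel_prob_on_def)
    have "(\<integral>x. \<phi> x \<partial>\<mu>) \<le> (\<integral>x. Q \<partial>\<mu>)"
      using Q by (intro integral_mono borel_prob_on_integrable_continuous(2)[OF \<mu> compact_subshift] continuous_potential)
        (auto simp: borel_prob_on_space[OF \<mu>] abs_le_iff)
    then show "(\<integral>x. \<phi> x \<partial>\<mu>) \<le> Q" using prob_space by simp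
  qed
  have upper: "J t \<le> ?m" and ne: "?M \<noteq> {}" and entropy: "ln (L t) \<le> t * J t" if t: "t > 1" for t
  proof -
    interpret E: linked_eigendata A I \<nu> \<delta> \<alpha> "\<lambda>x. t * \<phi> x" "\<lambda>y. t * \<phi>s y" "\<lambda>p. t * W p" "L t" "Ls t" "H t" "Hs t" "R t" "Rs t"
      by (rule data[OF t])
    have J: "J t = (\<integral>x. \<phi> x \<partial>E.gibbs)"
      unfolding J_def by (rule E.bilateral_gibbs_right[OF continuous_potential])
    have mem: "E.gibbs \<in> ?M" using E.gibbs_prob E.gibbs_invariant by simp
    then show "?M \<noteq> {}" by blast
    show "J t \<le> ?m" unfolding J max_integral_def by (rule cSUP_upper[OF mem bdd])
    show "ln (L t) \<le> t * J t" using E.ln_eigenvalue_le by (simp add: J)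
  qed
  obtain C where C: "C \<ge> 0" "\<And>p q. p \<in> ?Bh \<Longrightarrow> q \<in> ?Bh \<Longrightarrow> \<bar>W p - W q\<bar> \<le> C * pair_dist p q powr \<alpha>"
    using W unfolding hoelder_on_def by auto
  obtain D where D: "D \<ge> 0" "\<And>x z. x \<in> ?B \<Longrightarrow> z \<in> ?B \<Longrightarrow> \<bar>\<phi> x - \<phi> z\<bar> \<le> D * seq_dist x z powr \<alpha>"
    using \<phi> unfolding hoelder_on_def by auto
  have lower: "?m \<le> J t - ln \<eta> / t + (C + D) * r powr \<alpha>"
    if t: "t > 1" and r: "0 < r" "r \<le> \<delta>" and \<eta>: "0 < \<eta>" "\<And>a. \<eta> \<le> measure \<nu> (ball a r)" for t r \<eta>
    unfolding max_integral_def
  proof (rule cSUP_least[OF ne[OF t]])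
    fix \<mu> assume "\<mu> \<in> ?M"
    then have \<mu>: "borel_prob_on ?B \<mu>" "distr \<mu> \<mu> shift = \<mu>" by auto
    interpret E: linked_eigendata A I \<nu> \<delta> \<alpha> "\<lambda>x. t * \<phi> x" "\<lambda>y. t * \<phi>s y" "\<lambda>p. t * W p" "L t" "Ls t" "H t" "Hs t" "R t" "Rs t"
      by (rule data[OF t])
    have scale: "\<bar>t * u - t * v\<bar> \<le> t * c * d" if "\<bar>u - v\<bar> \<le> c * d" for u v c d :: real
      using mult_left_mono[OF that, of t] t by (simp add: right_diff_distrib[symmetric] abs_mult mult.assoc)
    have "(\<integral>x. t * \<phi> x \<partial>\<mu>) \<le> ln (L t) - ln \<eta> + (t * C + t * D) * r powr \<alpha>"
      using t C D by (intro E.integral_le_ln_eigenvalue \<mu> r \<eta> scale) auto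
    then have "t * (\<integral>x. \<phi> x \<partial>\<mu>) \<le> t * (J t - ln \<eta> / t + (C + D) * r powr \<alpha>)"
      using entropy[OF t] t by (simp add: algebra_simps)
    then show "(\<integral>x. \<phi> x \<partial>\<mu>) \<le> J t - ln \<eta> / t + (C + D) * r powr \<alpha>"
      using t by simp
  qed
  show ?thesis
  proof (rule tendstoI)
    fix e :: real assume e: "e > 0"
    have "((\<lambda>r. (C + D) * r powr \<alpha>) \<longlongrightarrow> (C + D) * 0 powr \<alpha>) (at_right 0)"
      using \<alpha> by (intro tendsto_mult_left tendsto_powr' tendsto_ident_at tendsto_const)
        (auto simp: eventually_at_filter)
    then have "\<forall>\<^sub>F r in at_right 0. (C + D) * r powr \<alpha> < e / 2"
      using e by (intro order_tendstoD) auto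
    moreover have "\<forall>\<^sub>F r in at_right 0. 0 < r \<and> r \<le> \<delta>"
      using \<delta> by (auto simp: eventually_at_right intro: exI[of _ \<delta>])
    ultimately obtain r where r: "(C + D) * r powr \<alpha> < e / 2" "0 < r" "r \<le> \<delta>"
      using eventually_happens[OF eventually_conj] by (metis (mono_tags, lifting) trivial_limit_at_right_real)
    obtain \<eta> where \<eta>: "\<eta> > 0" "\<And>a. \<eta> \<le> measure \<nu> (ball a r)"
      using full_support_ball_lower_bound[OF M_compact \<nu> full r(2)] by blast
    have "((\<lambda>t. - ln \<eta> / t) \<longlongrightarrow> 0) at_top"
      by (intro tendsto_divide_0[OF tendsto_const] filterlim_at_top_imp_at_infinity filterlim_ident)
    then have "\<forall>\<^sub>F t in at_top. - ln \<eta> / t < e / 2"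
      using e by (intro order_tendstoD) auto
    then show "\<forall>\<^sub>F t in at_top. dist (J t) ?m < e"
      using eventually_gt_at_top[of 1]
    proof eventually_elim
      case (elim t)
      have "?m < J t + e"
        using lower[OF elim(2) r(2,3) \<eta>] elim(1) r(1) unfolding minus_divide_left[symmetric] by linarith
      then show ?case using upper[OF elim(2)] e by (simp add: dist_real_def)
    qed
  qed
qed

lemma accumulation_point_integral:
  fixes g :: "'x::topological_space \<Rightarrow> real"
  assumes acc: "weak_star_accumulation_at_top Y m \<mu>" and g: "continuous_on Y g"
    and lim: "((\<lambda>t. \<integral>x. g x \<partial>m t) \<longlongrightarrow> a) at_top"
  shows "(\<integral>x. g x \<partial>\<mu>) = a"
proof (rule ccontr)
  assume "(\<integral>x. g x \<partial>\<mu>) \<noteq> a"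
  define e where "e = \<bar>(\<integral>x. g x \<partial>\<mu>) - a\<bar> / 2"
  have e: "e > 0" using \<open>(\<integral>x. g x \<partial>\<mu>) \<noteq> a\<close> by (simp add: e_def)
  have "\<exists>\<^sub>F t in at_top. \<forall>g'\<in>{g}. \<bar>(\<integral>x. g' x \<partial>m t) - (\<integral>x. g' x \<partial>\<mu>)\<bar> < e"
    using acc g e unfolding weak_star_accumulation_at_top_def by blast
  moreover have "\<forall>\<^sub>F t in at_top. dist (\<integral>x. g x \<partial>m t) a < e"
    using lim e by (rule tendstoD)
  ultimately have "\<exists>\<^sub>F t in at_top. (\<forall>g'\<in>{g}. \<bar>(\<integral>x. g' x \<partial>m t) - (\<integral>x. g' x \<partial>\<mu>)\<bar> < e) \<and> dist (\<integral>x. g x \<partial>m t) a < e"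
    by (rule frequently_eventually_frequently)
  then obtain t where "\<bar>(\<integral>x. g x \<partial>m t) - (\<integral>x. g x \<partial>\<mu>)\<bar> < e" "\<bar>(\<integral>x. g x \<partial>m t) - a\<bar> < e"
    by (auto dest: frequently_ex simp: dist_real_def)
  moreover have "2 * e = \<bar>(\<integral>x. g x \<partial>\<mu>) - a\<bar>" by (simp add: e_def)
  ultimately show False by arith
qed

theorem theorem2:
  fixes A :: "'a::{metric_space, second_countable_topology} \<Rightarrow> 'a \<Rightarrow> real"
    and I :: "real set"
    and \<nu> :: "'a measure"
    and B Bs :: "(nat \<Rightarrow> 'a) set"
    and Bh :: "((nat \<Rightarrow> 'a) \<times> (nat \<Rightarrow> 'a)) set"
    and \<alpha> c l ls :: real
    and \<phi> \<phi>s h hs f fs :: "(nat \<Rightarrow> 'a) \<Rightarrow> real"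
    and W :: "(nat \<Rightarrow> 'a) \<times> (nat \<Rightarrow> 'a) \<Rightarrow> real"
    and \<rho> \<rho>s \<mu> \<mu>s :: "(nat \<Rightarrow> 'a) measure"
  assumes B: "B = subshift A I"
    and Bs: "Bs = transpose_subshift A I"
    and Bh: "Bh = bilateral_subshift A I"
    and M_compact: "compact (UNIV :: 'a set)"
    and A_cont: "continuous_on UNIV (\<lambda>(a, b). A a b)"
    and I_compact: "compact I"
    and \<nu>: "borel_prob_on UNIV \<nu>" "full_support \<nu>"
    and s_loc_const: "locally_constant (sect A I)"
    and transitive: "topologically_transitive B shift"
    and decomposition: "spectral_decomposition B shift"
    and \<alpha>: "\<alpha> > 0"
    and \<phi>: "hoelder_on seq_dist \<alpha> B \<phi>"
    and W: "hoelder_on pair_dist \<alpha> Bh W"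
    and \<phi>s: "hoelder_on seq_dist \<alpha> Bs \<phi>s"
    and cohomology: "\<forall>(y, x) \<in> Bh. \<phi>s y = \<phi> (tau y x) + W (shift y, tau y x) - W (y, x)"
    and rpf: "rpf_data \<nu> \<alpha> B (sect A I) \<phi> l h \<rho>"
    and rpf_star: "rpf_data \<nu> \<alpha> Bs (sect_star A I) \<phi>s ls hs \<rho>s"
    and gibbs: "gibbs_state \<nu> B (sect A I) \<phi> l h \<mu>"
    and gibbs_star: "gibbs_state \<nu> Bs (sect_star A I) \<phi>s ls hs \<mu>s"
    and c: "c = bi_const A I W \<rho>s \<rho>"
    and f: "\<forall>x\<in>B. f x = (\<integral>y. bi_kernel A I W c y x \<partial>\<rho>s)"
    and fs: "\<forall>y\<in>Bs. fs y = (\<integral>x. bi_kernel A I W c y x \<partial>\<rho>)"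
  shows
    "((\<forall>x\<in>B. ruelle \<nu> (sect A I) \<phi> f x = l * f x) \<and>
      (\<forall>y\<in>Bs. ruelle \<nu> (sect_star A I) \<phi>s fs y = ls * fs y) \<and>
      (\<integral>x. f x \<partial>\<rho>) = 1 \<and> (\<integral>y. fs y \<partial>\<rho>s) = 1 \<and> l = ls) \<and>
     (sets (bi_measure A I W c \<rho>s \<rho>) = sets (restrict_space borel Bh) \<and>
      (\<forall>\<psi> :: (nat \<Rightarrow> 'a) \<Rightarrow> real. continuous_on B \<psi> \<longrightarrow>
         continuous_on Bh (\<lambda>(y, x). \<psi> x) \<and>
         (\<integral>(y, x). \<psi> x \<partial>bi_measure A I W c \<rho>s \<rho>) = (\<integral>x. \<psi> x \<partial>\<mu>)) \<and>
      (\<forall>\<psi>s :: (nat \<Rightarrow> 'a) \<Rightarrow> real. continuous_on Bs \<psi>s \<longrightarrow>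
         continuous_on Bh (\<lambda>(y, x). \<psi>s y) \<and>
         (\<integral>(y, x). \<psi>s y \<partial>bi_measure A I W c \<rho>s \<rho>) = (\<integral>y. \<psi>s y \<partial>\<mu>s))) \<and>
     (\<forall>(L :: real \<Rightarrow> real) (Ls :: real \<Rightarrow> real)
       (H :: real \<Rightarrow> (nat \<Rightarrow> 'a) \<Rightarrow> real) (Hs :: real \<Rightarrow> (nat \<Rightarrow> 'a) \<Rightarrow> real)
       (R :: real \<Rightarrow> (nat \<Rightarrow> 'a) measure) (Rs :: real \<Rightarrow> (nat \<Rightarrow> 'a) measure) \<mu>h.
       (\<forall>t>1. rpf_data \<nu> \<alpha> B (sect A I) (\<lambda>x. t * \<phi> x) (L t) (H t) (R t)) \<and>
       (\<forall>t>1. rpf_data \<nu> \<alpha> Bs (sect_star A I) (\<lambda>y. t * \<phi>s y) (Ls t) (Hs t) (Rs t)) \<and>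
       weak_star_accumulation_at_top Bh
         (\<lambda>t. bi_measure A I (\<lambda>p. t * W p) (bi_const A I (\<lambda>p. t * W p) (Rs t) (R t)) (Rs t) (R t))
         \<mu>h \<longrightarrow>
       (\<integral>(y, x). \<phi> x \<partial>\<mu>h) = max_integral B \<phi>)"
proof -
  have rpf': "rpf_data \<nu> \<alpha> (subshift A I) (sect A I) \<phi> l h \<rho>"
    "rpf_data \<nu> \<alpha> (transpose_subshift A I) (sect_star A I) \<phi>s ls hs \<rho>s"
    using rpf rpf_star by (simp_all add: B Bs)
  interpret K: compact_alphabet A I \<nu>
    using M_compact A_cont compact_imp_closed[OF I_compact] \<nu>(1) by unfold_locales
  interpret F: compact_alphabet "\<lambda>a b. A b a" I \<nu> by (rule K.flipped_alphabet)
  have star_local: "\<exists>U. open U \<and> y 0 \<in> U \<and> (\<forall>a\<in>U. sect_star A I a = sect_star A I (y 0))"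
    if "y \<in> transpose_subshift A I" for y
    using F.sect_locally_constant[of \<alpha> \<phi>s hs ls y] that s_loc_const \<nu>(2) \<alpha> \<phi>s[unfolded Bs] rpf'(2)
    unfolding K.flips rpf_data_def by blast
  have "\<exists>\<delta>>0. \<forall>b\<in>UNIV. \<forall>c. dist b c < \<delta> \<longrightarrow> sect A I c = sect A I b"
    by (rule uniformly_locally_constant[OF M_compact]) (use s_loc_const in \<open>unfold locally_constant_def, blast\<close>)
  then obtain \<delta>1 where \<delta>1: "\<delta>1 > 0" "\<And>b c. dist b c < \<delta>1 \<Longrightarrow> sect A I c = sect A I b" by blast
  have "\<exists>\<delta>>0. \<forall>b\<in>(\<lambda>y. y 0) ` transpose_subshift A I. \<forall>c. dist b c < \<delta> \<longrightarrow> sect_star A I c = sect_star A I b"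
    by (rule uniformly_locally_constant, rule compact_continuous_image)
      (auto intro: K.compact_transpose star_local continuous_on_subset[OF continuous_on_product_coordinates])
  then obtain \<delta>2 where \<delta>2: "\<delta>2 > 0"
    "\<And>y c. y \<in> transpose_subshift A I \<Longrightarrow> dist (y 0) c < \<delta>2 \<Longrightarrow> sect_star A I c = sect_star A I (y 0)" by blast
  define \<delta> where "\<delta> = min \<delta>1 \<delta>2"
  interpret P: linked_potentials A I \<nu> \<delta> \<alpha> \<phi> \<phi>s W
  proof unfold_locales
    show "\<delta> > 0" using \<delta>1(1) \<delta>2(1) by (simp add: \<delta>_def)
    show "sect A I b = sect A I (x 0)" if "dist (x 0) b < \<delta>" for x b
      using \<delta>1(2) that by (simp add: \<delta>_def)
    show "sect_star A I b = sect_star A I (y 0)" if "y \<in> transpose_subshift A I" "dist (y 0) b < \<delta>" for y b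
      using \<delta>2(2) that by (simp add: \<delta>_def)
    show "sect A I (x 0) \<noteq> {}" if "x \<in> subshift A I" for x
      using rpf'(1) that unfolding rpf_data_def by (intro K.eigenfunction_section_nonempty) auto
    show "sect_star A I (y 0) \<noteq> {}" if "y \<in> transpose_subshift A I" for y
      using rpf'(2) that F.eigenfunction_section_nonempty[of \<phi>s hs y ls] unfolding rpf_data_def K.flips by blast
    show "\<phi>s y = \<phi> (tau y x) + W (shift y, tau y x) - W (y, x)" if "(y, x) \<in> bilateral_subshift A I" for y x
      using cohomology that by (auto simp: Bh)
  qed (use \<alpha> \<phi> W \<phi>s in \<open>simp_all add: B Bs Bh\<close>)
  interpret E: linked_eigendata A I \<nu> \<delta> \<alpha> \<phi> \<phi>s W l ls h hs \<rho> \<rho>s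
    using rpf' by unfold_locales
  interpret EF: linked_eigendata "\<lambda>a b. A b a" I \<nu> \<delta> \<alpha> \<phi>s \<phi> "\<lambda>(x, y). W (y, x)" ls l hs h \<rho>s \<rho>
    by (rule E.flipped_eigendata)
  have f': "f x = E.density_fun x" if "x \<in> B" for x
    using f that by (simp add: c E.marginal_def)
  have fs': "fs y = (\<integral>x. bi_kernel A I W E.normalizer y x \<partial>\<rho>)" if "y \<in> Bs" for y
    using fs that by (simp add: c)
  have part1: "(\<forall>x\<in>B. ruelle \<nu> (sect A I) \<phi> f x = l * f x) \<and>
      (\<forall>y\<in>Bs. ruelle \<nu> (sect_star A I) \<phi>s fs y = ls * fs y) \<and>
      (\<integral>x. f x \<partial>\<rho>) = 1 \<and> (\<integral>y. fs y \<partial>\<rho>s) = 1 \<and> l = ls"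
  proof (intro conjI ballI)
    fix x assume "x \<in> B"
    then show "ruelle \<nu> (sect A I) \<phi> f x = l * f x"
      using P.transfer_cong[of x f E.density_fun] E.transfer_marginal' by (simp add: f' B)
  next
    fix y assume y: "y \<in> Bs"
    have "ruelle \<nu> (sect_star A I) \<phi>s fs y
        = ruelle \<nu> (sect_star A I) \<phi>s (\<lambda>y. \<integral>x. bi_kernel A I W E.normalizer y x \<partial>\<rho>) y"
      using EF.transfer_cong[of y fs "\<lambda>y. \<integral>x. bi_kernel A I W E.normalizer y x \<partial>\<rho>"] y fs'
      unfolding K.flips Bs by blast
    then show "ruelle \<nu> (sect_star A I) \<phi>s fs y = ls * fs y"
      using E.transfer_marginal_star y by (simp add: fs' Bs)
  next
    have "(\<integral>x. f x \<partial>\<rho>) = (\<integral>x. E.density_fun x \<partial>\<rho>)"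
      by (intro Bochner_Integration.integral_cong refl) (simp add: f' B borel_prob_on_space[OF E.eigenprob])
    then show "(\<integral>x. f x \<partial>\<rho>) = 1" by (simp add: E.integral_density_fun)
    have "(\<integral>y. fs y \<partial>\<rho>s) = (\<integral>y. (\<integral>x. bi_kernel A I W E.normalizer y x \<partial>\<rho>) \<partial>\<rho>s)"
      by (intro Bochner_Integration.integral_cong refl) (simp add: fs' Bs borel_prob_on_space[OF E.eigenprob_star])
    then show "(\<integral>y. fs y \<partial>\<rho>s) = 1" by (simp add: E.integral_marginal_star)
  qed (rule E.eigenvalues_eq[symmetric])
  have cont_right: "continuous_on Bh (\<lambda>(y, x). \<psi> x)" if "continuous_on B \<psi>" for \<psi> :: "(nat \<Rightarrow> 'a) \<Rightarrow> real"
    using continuous_on_subset[OF E.continuous_on_right E.bilateral_subset] that by (simp add: B Bh)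
  have cont_left: "continuous_on Bh (\<lambda>(y, x). \<psi> y)" if "continuous_on Bs \<psi>" for \<psi> :: "(nat \<Rightarrow> 'a) \<Rightarrow> real"
    using continuous_on_subset[OF E.continuous_on_left E.bilateral_subset] that by (simp add: Bs Bh)
  have part2: "sets (bi_measure A I W c \<rho>s \<rho>) = sets (restrict_space borel Bh) \<and>
      (\<forall>\<psi> :: (nat \<Rightarrow> 'a) \<Rightarrow> real. continuous_on B \<psi> \<longrightarrow>
         continuous_on Bh (\<lambda>(y, x). \<psi> x) \<and>
         (\<integral>(y, x). \<psi> x \<partial>bi_measure A I W c \<rho>s \<rho>) = (\<integral>x. \<psi> x \<partial>\<mu>)) \<and>
      (\<forall>\<psi>s :: (nat \<Rightarrow> 'a) \<Rightarrow> real. continuous_on Bs \<psi>s \<longrightarrow>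
         continuous_on Bh (\<lambda>(y, x). \<psi>s y) \<and>
         (\<integral>(y, x). \<psi>s y \<partial>bi_measure A I W c \<rho>s \<rho>) = (\<integral>y. \<psi>s y \<partial>\<mu>s))"
  proof (intro conjI allI impI)
    show "sets (bi_measure A I W c \<rho>s \<rho>) = sets (restrict_space borel Bh)"
      unfolding c Bh by (rule E.sets_bilateral_gibbs)
  next
    fix \<psi> :: "(nat \<Rightarrow> 'a) \<Rightarrow> real" assume "continuous_on B \<psi>"
    then show "(\<integral>(y, x). \<psi> x \<partial>bi_measure A I W c \<rho>s \<rho>) = (\<integral>x. \<psi> x \<partial>\<mu>)"
      using E.bilateral_gibbs_right[of \<psi>] E.gibbs_state_eq[of \<mu>] gibbs by (simp add: B c)
  next
    fix \<psi>s :: "(nat \<Rightarrow> 'a) \<Rightarrow> real" assume "continuous_on Bs \<psi>s"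
    then show "(\<integral>(y, x). \<psi>s y \<partial>bi_measure A I W c \<rho>s \<rho>) = (\<integral>y. \<psi>s y \<partial>\<mu>s)"
      using E.bilateral_gibbs_left[of \<psi>s \<mu>s] gibbs_star by (simp add: Bs c)
  qed (fact cont_right cont_left)+
  have part3: "(\<integral>(y, x). \<phi> x \<partial>\<mu>h) = max_integral B \<phi>"
    if rpf_t: "\<forall>t>1. rpf_data \<nu> \<alpha> B (sect A I) (\<lambda>x. t * \<phi> x) (L t) (H t) (R t)"
      and rpf_star_t: "\<forall>t>1. rpf_data \<nu> \<alpha> Bs (sect_star A I) (\<lambda>y. t * \<phi>s y) (Ls t) (Hs t) (Rs t)"
      and acc: "weak_star_accumulation_at_top Bh
         (\<lambda>t. bi_measure A I (\<lambda>p. t * W p) (bi_const A I (\<lambda>p. t * W p) (Rs t) (R t)) (Rs t) (R t)) \<mu>h"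
    for L Ls :: "real \<Rightarrow> real" and H Hs :: "real \<Rightarrow> (nat \<Rightarrow> 'a) \<Rightarrow> real"
      and R Rs :: "real \<Rightarrow> (nat \<Rightarrow> 'a) measure" and \<mu>h
  proof (rule accumulation_point_integral[OF acc])
    show "continuous_on Bh (\<lambda>(y, x). \<phi> x)"
      using cont_right P.continuous_potential by (simp add: B)
    have "linked_eigendata A I \<nu> \<delta> \<alpha> (\<lambda>x. t * \<phi> x) (\<lambda>y. t * \<phi>s y) (\<lambda>p. t * W p) (L t) (Ls t) (H t) (Hs t) (R t) (Rs t)"
      if "t > 1" for t
      using P.scaled[of t] rpf_t rpf_star_t that
      by (simp add: linked_eigendata_def linked_eigendata_axioms_def B Bs)
    then show "((\<lambda>t. \<integral>(y, x). \<phi> x \<partial>bi_measure A I (\<lambda>p. t * W p) (bi_const A I (\<lambda>p. t * W p) (Rs t) (R t)) (Rs t) (R t))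
        \<longlongrightarrow> max_integral B \<phi>) at_top"
      unfolding B by (rule P.gibbs_maximizing_limit[OF \<nu>(2)])
  qed
  show ?thesis using part1 part2 part3 by blast
qed

end
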